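(* Let $u$, belonging to $W^{r,p}(\Omega)$ for all $r\in\mathbb{N}$, be the solution of the variational problem: $u\in W$, $a(u,v)=l(v)$ for all $v\in V$, with $W=W^{m,p}(\Omega)$ and $V=W^{m',p'}(\Omega)$. Let $k,m,p$ be fixed such that: if $\frac np<1$ then $m\le k$; and if $\frac np\ge1$ then $m\le k-1$ and $k+1-\frac np>0$. Assume that for every $k\in\mathbb{N}$, $\lim_{q\to+\infty}\alpha_{h,k+q}=\alpha^*_{h,k}\in\mathbb{R}\setminus\{0\}$, and that $$\lim_{q\to+\infty}\frac{|u|_{k+q+2,p,\Omega}}{|u|_{k+q+1,p,\Omega}}=l_0\quad\text{for some } l_0\in(0,+\infty).$$ Let $(T_{\mathcal{P}_q})_{q\in\mathbb{N}^*}$ be the sequence of regular distributions on $\mathbb{R}$ associated with the functions $\mathcal{P}_q$ defined in the context. Then $(T_{\mathcal{P}_q})_{q\in\mathbb{N}^*}$ converges, with respect to the weak-* topology on $\mathcal{D}'(\mathbb{R})$, to the Heaviside distribution $T_H$; that is, for every $\varphi\in\mathcal{D}(\mathbb{R})$, $\lim_{q\to+\infty}\langle T_{\mathcal{P}_q},\varphi\rangle=\langle T_H,\varphi\rangle$.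
   Context: Sobolev spaces: $\Omega\subset\mathbb{R}^n$ is open; $W^{m,p}(\Omega)$ is the usual Sobolev space ($1<p<+\infty$), with seminorms $|u|_{l,p,\Omega}=\big(\sum_{|\alpha|=l}\|\partial^\alpha u\|_{L^p}^p\big)^{1/p}$. Here $m,m'$ are nonzero (positive) integers, and $p,p'$ are positive reals with $p\ne2$, $p'>1$, $\frac1p+\frac1{p'}=1$. Variational setting: $l$ is a continuous linear form on $V$, $a$ is a continuous bilinear form on $W\times V$, and $\|a\|_{W^{m,p},W^{m',p'}}=\inf\{C>0:\ |a(w,v)|\le C\|w\|_W\|v\|_V\ \forall (w,v)\in W\times V\}$. Assume the inf-sup condition $\inf_{w\in W}\sup_{v\in V}\frac{a(w,v)}{\|w\|_W\|v\|_V}\ge\alpha$ for some $\alpha>0$, and that for $v\in V$, $a(w,v)=0$ for all $w\in W$ implies $v=0$. $\Omega$ is exactly covered by a regular mesh of $n$-simplexes of mesh size $h$. For each degree $k\ge1$, $\alpha_{h,k}>0$ denotes the constant of the discrete inf-sup condition $\inf_{w_h\in W_h}\sup_{v_h\in V_h}\frac{a(w_h,v_h)}{\|w_h\|\,\|v_h\|}\ge\alpha_{h,k}$ for the $P_k$ finite element spaces $W_h\subset W$, $V_h\subset V$ (with $\dim W_h=\dim V_h$; functions whose restriction to each simplex is a polynomial of degree at most $k$), for which one also assumes that for $v_h\in V_h$, $a(w_h,v_h)=0$ for all $w_h\in W_h$ implies $v_h=0$. (In the infima and suprema, the zero vector is excluded.) The sequence $h_q^*$: for $q\in\mathbb{N}^*=\{1,2,\dots\}$,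 $$h^*_q=\left[\frac{1+\frac{\|a\|_{W^{m,p},W^{m',p'}}}{\alpha_{h,k}}}{1+\frac{\|a\|_{W^{m,p},W^{m',p'}}}{\alpha_{h,k+q}}}\left(\frac{k+n}{k+q+n}\right)^{n}\left(\frac{k}{k+q}\right)^{m(n+2)}\frac{(k+q-m)!}{(k-m)!}\,\frac{k+q+1-m-\frac np}{k+1-m-\frac np}\,\frac{|u|_{k+1,p,\Omega}}{|u|_{k+q+1,p,\Omega}}\right]^{1/q}.$$ The functions $\mathcal{P}_q$: for $q\in\mathbb{N}^*$, with $h_q^*$ treated as a given number independent of the argument of $\mathcal{P}_q$, $$\mathcal{P}_q(h)=\begin{cases}0 & \text{if } h\le0,\\ 1-\frac12\left(\frac{h}{h^*_q}\right)^q & \text{if } 0<h\le h^*_q,\\ \frac12\left(\frac{h^*_q}{h}\right)^q & \text{if } h\ge h^*_q.\end{cases}$$ (For $h>0$, $\mathcal{P}_q(h)$ is the probability law used to measure whether the $P_{k+q}$ finite element is more accurate than the $P_k$ finite element in the $W^{m,p}$-norm.) Distributions: $\mathcal{D}(\mathbb{R})$ is the space of $C^\infty$ functions with compact support in $\mathbb{R}$ and $\mathcal{D}'(\mathbb{R})$ is the space of distributions on $\mathbb{R}$. $\langle T_{\mathcal{P}_q},\varphi\rangle=\int_{\mathbb{R}}\mathcal{P}_q(h)\varphi(h)\,dh$ and $\langle T_H,\varphi\rangle=\int_0^{+\infty}\varphi(h)\,dh$.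
   Formalization: The formal statement additionally assumes k+1-m-n/p ≠ 0, since h_q^* divides by this number and the stated conditions on k, m, p allow it to vanish (e.g. n=6, p=3, k=2, m=1), leaving h_q^* undefined. *)

theory Defs
  imports "HOL-Analysis.Analysis" "HOL-Library.Function_Algebras"
begin

text \<open>
  \<open>\<real>\<^sup>n\<close> is an arbitrary \<open>'a :: euclidean_space\<close> with \<open>n = DIM('a)\<close> and coordinates \<open>x \<bullet> b\<close>
  for \<open>b \<in> Basis\<close>. Taking \<open>'a = real\<close> gives the test functions on the real line.
\<close>

section \<open>Test functions and distributions on the line\<close>

definition partial_deriv :: "'a::euclidean_space \<Rightarrow> ('a \<Rightarrow> real) \<Rightarrow> 'a \<Rightarrow> real" where
  "partial_deriv b f x = deriv (\<lambda>t. f (x + t *\<^sub>R b)) 0"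

fun partial_derivs :: "'a::euclidean_space list \<Rightarrow> ('a \<Rightarrow> real) \<Rightarrow> 'a \<Rightarrow> real" where
  "partial_derivs [] f = f"
| "partial_derivs (b # bs) f = partial_deriv b (partial_derivs bs f)"

definition smooth :: "('a::euclidean_space \<Rightarrow> real) \<Rightarrow> bool" where
  "smooth f \<longleftrightarrow> (\<forall>bs\<in>lists Basis. \<forall>x. partial_derivs bs f differentiable at x)"

definition test_functions :: "'a::euclidean_space set \<Rightarrow> ('a \<Rightarrow> real) set" where
  "test_functions \<Omega> =
     {\<phi>. smooth \<phi> \<and> (\<exists>K. compact K \<and> K \<subseteq> \<Omega> \<and> (\<forall>x. x \<notin> K \<longrightarrow> \<phi> x = 0))}"

text \<open>
  Continuity of a linear form on the test functions is expressed by the usual estimates on each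
  compact set. Only the values of a functional on test functions matter.
\<close>

definition distribution :: "((real \<Rightarrow> real) \<Rightarrow> real) \<Rightarrow> bool" where
  "distribution T \<longleftrightarrow>
     (\<forall>\<phi>\<in>test_functions UNIV. \<forall>\<psi>\<in>test_functions UNIV. T (\<lambda>x. \<phi> x + \<psi> x) = T \<phi> + T \<psi>) \<and>
     (\<forall>\<phi>\<in>test_functions UNIV. \<forall>c. T (\<lambda>x. c * \<phi> x) = c * T \<phi>) \<and>
     (\<forall>K. compact K \<longrightarrow> (\<exists>C N. \<forall>\<phi>\<in>test_functions UNIV. (\<forall>x. x \<notin> K \<longrightarrow> \<phi> x = 0) \<longrightarrow>
        \<bar>T \<phi>\<bar> \<le> C * (\<Sum>j\<le>(N::nat). SUP x. \<bar>(deriv ^^ j) \<phi> x\<bar>)))"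

definition regular_distribution :: "(real \<Rightarrow> real) \<Rightarrow> (real \<Rightarrow> real) \<Rightarrow> real" where
  "regular_distribution f \<phi> = (LINT x|lebesgue. f x * \<phi> x)"

definition heaviside_distribution :: "(real \<Rightarrow> real) \<Rightarrow> real" where
  "heaviside_distribution \<phi> = (LINT x:{0..}|lebesgue. \<phi> x)"

text \<open>The sequence is indexed by \<open>q \<ge> 1\<close>; its entry at \<open>0\<close> is irrelevant.\<close>

definition converges_weak_star ::
    "(nat \<Rightarrow> (real \<Rightarrow> real) \<Rightarrow> real) \<Rightarrow> ((real \<Rightarrow> real) \<Rightarrow> real) \<Rightarrow> bool" where
  "converges_weak_star T S \<longleftrightarrow>
     (\<forall>q\<ge>1. distribution (T q)) \<and> distribution S \<and>
     (\<forall>\<phi>\<in>test_functions UNIV. (\<lambda>q. T q \<phi>) \<longlonglongrightarrow> S \<phi>)"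


section \<open>Sobolev spaces\<close>

definition multi_indices :: "nat \<Rightarrow> ('a::euclidean_space \<Rightarrow> nat) set" where
  "multi_indices l = {\<alpha>. (\<forall>b. b \<notin> Basis \<longrightarrow> \<alpha> b = 0) \<and> (\<Sum>b\<in>Basis. \<alpha> b) = l}"

definition locally_integrable :: "'a::euclidean_space set \<Rightarrow> ('a \<Rightarrow> real) \<Rightarrow> bool" where
  "locally_integrable \<Omega> f \<longleftrightarrow> (\<forall>K. compact K \<and> K \<subseteq> \<Omega> \<longrightarrow> set_integrable lebesgue K f)"

text \<open>
  \<open>g = \<partial>\<^sup>\<alpha> u\<close> weakly. By Schwarz' theorem \<open>\<partial>\<^sup>\<alpha> \<phi>\<close> is \<open>partial_derivs bs \<phi>\<close> for any list \<open>bs\<close>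
  of basis vectors in which each \<open>b\<close> occurs \<open>\<alpha> b\<close> times.
\<close>

definition weak_deriv ::
    "'a::euclidean_space set \<Rightarrow> ('a \<Rightarrow> nat) \<Rightarrow> ('a \<Rightarrow> real) \<Rightarrow> ('a \<Rightarrow> real) \<Rightarrow> bool" where
  "weak_deriv \<Omega> \<alpha> u g \<longleftrightarrow>
     locally_integrable \<Omega> u \<and> locally_integrable \<Omega> g \<and>
     (\<forall>\<phi>\<in>test_functions \<Omega>. \<forall>bs. (\<forall>b. count_list bs b = \<alpha> b) \<longrightarrow>
        (LINT x:\<Omega>|lebesgue. u x * partial_derivs bs \<phi> x) =
        (-1) ^ length bs * (LINT x:\<Omega>|lebesgue. g x * \<phi> x))"

definition Lp_on :: "real \<Rightarrow> 'a::euclidean_space set \<Rightarrow> ('a \<Rightarrow> real) set" where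
  "Lp_on p \<Omega> = {f. set_borel_measurable lebesgue \<Omega> f \<and>
                   set_integrable lebesgue \<Omega> (\<lambda>x. \<bar>f x\<bar> powr p)}"

definition Lp_norm :: "real \<Rightarrow> 'a::euclidean_space set \<Rightarrow> ('a \<Rightarrow> real) \<Rightarrow> real" where
  "Lp_norm p \<Omega> f = (LINT x:\<Omega>|lebesgue. \<bar>f x\<bar> powr p) powr (1 / p)"

text \<open>
  Elements of \<open>W\<^sup>m\<^sup>,\<^sup>p(\<Omega>)\<close> are represented by functions on the whole space whose values outside \<open>\<Omega>\<close>
  are irrelevant; two representatives are the same element iff they agree almost everywhere
  on \<open>\<Omega>\<close>.
\<close>

definition sobolev :: "nat \<Rightarrow> real \<Rightarrow> 'a::euclidean_space set \<Rightarrow> ('a \<Rightarrow> real) set" where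
  "sobolev m p \<Omega> = {u. \<forall>l\<le>m. \<forall>\<alpha>\<in>multi_indices l. \<exists>g\<in>Lp_on p \<Omega>. weak_deriv \<Omega> \<alpha> u g}"

text \<open>Weak derivatives are unique almost everywhere on an open \<open>\<Omega>\<close>, so the choice is harmless.\<close>

definition the_weak_deriv ::
    "'a::euclidean_space set \<Rightarrow> ('a \<Rightarrow> nat) \<Rightarrow> ('a \<Rightarrow> real) \<Rightarrow> 'a \<Rightarrow> real" where
  "the_weak_deriv \<Omega> \<alpha> u = (SOME g. weak_deriv \<Omega> \<alpha> u g)"

definition sobolev_seminorm ::
    "nat \<Rightarrow> real \<Rightarrow> 'a::euclidean_space set \<Rightarrow> ('a \<Rightarrow> real) \<Rightarrow> real" where
  "sobolev_seminorm l p \<Omega> u =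
     (\<Sum>\<alpha>\<in>multi_indices l. Lp_norm p \<Omega> (the_weak_deriv \<Omega> \<alpha> u) powr p) powr (1 / p)"

definition sobolev_norm ::
    "nat \<Rightarrow> real \<Rightarrow> 'a::euclidean_space set \<Rightarrow> ('a \<Rightarrow> real) \<Rightarrow> real" where
  "sobolev_norm m p \<Omega> u = (\<Sum>l\<le>m. sobolev_seminorm l p \<Omega> u powr p) powr (1 / p)"

definition zero_on :: "'a::euclidean_space set \<Rightarrow> ('a \<Rightarrow> real) \<Rightarrow> bool" where
  "zero_on \<Omega> f \<longleftrightarrow> (AE x in lebesgue. x \<in> \<Omega> \<longrightarrow> f x = 0)"


section \<open>Linear and bilinear forms, inf-sup conditions\<close>

abbreviation scale_fun :: "real \<Rightarrow> ('a \<Rightarrow> real) \<Rightarrow> 'a \<Rightarrow> real" where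
  "scale_fun c f \<equiv> (\<lambda>x. c * f x)"

interpretation fun_vs: vector_space scale_fun
  by unfold_locales (auto simp: fun_eq_iff algebra_simps)

definition linear_form_on :: "('a \<Rightarrow> real) set \<Rightarrow> (('a \<Rightarrow> real) \<Rightarrow> real) \<Rightarrow> bool" where
  "linear_form_on X l \<longleftrightarrow>
     (\<forall>f\<in>X. \<forall>g\<in>X. l (f + g) = l f + l g) \<and> (\<forall>f\<in>X. \<forall>c. l (scale_fun c f) = c * l f)"

definition continuous_linear_form ::
    "('a \<Rightarrow> real) set \<Rightarrow> (('a \<Rightarrow> real) \<Rightarrow> real) \<Rightarrow> (('a \<Rightarrow> real) \<Rightarrow> real) \<Rightarrow> bool" where
  "continuous_linear_form V nV l \<longleftrightarrow>
     linear_form_on V l \<and> (\<exists>C. \<forall>v\<in>V. \<bar>l v\<bar> \<le> C * nV v)"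

definition continuous_bilinear_form ::
    "('a \<Rightarrow> real) set \<Rightarrow> (('a \<Rightarrow> real) \<Rightarrow> real) \<Rightarrow> ('a \<Rightarrow> real) set \<Rightarrow> (('a \<Rightarrow> real) \<Rightarrow> real) \<Rightarrow>
     (('a \<Rightarrow> real) \<Rightarrow> ('a \<Rightarrow> real) \<Rightarrow> real) \<Rightarrow> bool" where
  "continuous_bilinear_form W nW V nV a \<longleftrightarrow>
     (\<forall>w\<in>W. linear_form_on V (\<lambda>v. a w v)) \<and> (\<forall>v\<in>V. linear_form_on W (\<lambda>w. a w v)) \<and>
     (\<exists>C. \<forall>w\<in>W. \<forall>v\<in>V. \<bar>a w v\<bar> \<le> C * nW w * nV v)"

definition bilinear_form_norm ::
    "('a \<Rightarrow> real) set \<Rightarrow> (('a \<Rightarrow> real) \<Rightarrow> real) \<Rightarrow> ('a \<Rightarrow> real) set \<Rightarrow> (('a \<Rightarrow> real) \<Rightarrow> real) \<Rightarrow>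
     (('a \<Rightarrow> real) \<Rightarrow> ('a \<Rightarrow> real) \<Rightarrow> real) \<Rightarrow> real" where
  "bilinear_form_norm W nW V nV a = Inf {C. C > 0 \<and> (\<forall>w\<in>W. \<forall>v\<in>V. \<bar>a w v\<bar> \<le> C * nW w * nV v)}"

definition inf_sup ::
    "'a::euclidean_space set \<Rightarrow>
     ('a \<Rightarrow> real) set \<Rightarrow> (('a \<Rightarrow> real) \<Rightarrow> real) \<Rightarrow> ('a \<Rightarrow> real) set \<Rightarrow> (('a \<Rightarrow> real) \<Rightarrow> real) \<Rightarrow>
     (('a \<Rightarrow> real) \<Rightarrow> ('a \<Rightarrow> real) \<Rightarrow> real) \<Rightarrow> ereal" where
  "inf_sup \<Omega> W nW V nV a =
     (INF w\<in>{w\<in>W. \<not> zero_on \<Omega> w}. SUP v\<in>{v\<in>V. \<not> zero_on \<Omega> v}. ereal (a w v / (nW w * nV v)))"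

definition nondegenerate ::
    "'a::euclidean_space set \<Rightarrow> ('a \<Rightarrow> real) set \<Rightarrow> ('a \<Rightarrow> real) set \<Rightarrow>
     (('a \<Rightarrow> real) \<Rightarrow> ('a \<Rightarrow> real) \<Rightarrow> real) \<Rightarrow> bool" where
  "nondegenerate \<Omega> W V a \<longleftrightarrow> (\<forall>v\<in>V. (\<forall>w\<in>W. a w v = 0) \<longrightarrow> zero_on \<Omega> v)"


section \<open>Meshes and finite element spaces\<close>

text \<open>
  A conforming mesh of \<open>\<Omega>\<close> by \<open>n\<close>-simplexes with mesh size \<open>h\<close>, regular in the sense of Ciarlet:
  the ratio of the diameter of each simplex to the diameter of its largest inscribed ball is
  at most \<open>\<sigma>\<close>.
\<close>

definition inball_diameter :: "'a::euclidean_space set \<Rightarrow> real" where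
  "inball_diameter K = Sup {2 * r |r. r \<ge> 0 \<and> (\<exists>c. cball c r \<subseteq> K)}"

definition regular_mesh ::
    "real \<Rightarrow> real \<Rightarrow> 'a::euclidean_space set \<Rightarrow> 'a set set \<Rightarrow> bool" where
  "regular_mesh \<sigma> h \<Omega> \<T> \<longleftrightarrow>
     triangulation \<T> \<and> \<T> \<noteq> {} \<and> (\<forall>K\<in>\<T>. int DIM('a) simplex K) \<and>
     \<Union>\<T> = closure \<Omega> \<and>
     h = Max (diameter ` \<T>) \<and>
     (\<forall>K\<in>\<T>. diameter K \<le> \<sigma> * inball_diameter K)"

definition polynomial_of_degree_le :: "nat \<Rightarrow> ('a::euclidean_space \<Rightarrow> real) \<Rightarrow> bool" where
  "polynomial_of_degree_le k P \<longleftrightarrow>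
     (\<exists>c. \<forall>x. P x = (\<Sum>\<alpha>\<in>(\<Union>l\<le>k. multi_indices l). c \<alpha> * (\<Prod>b\<in>Basis. (x \<bullet> b) ^ \<alpha> b)))"

text \<open>
  Finite element functions are extended by \<open>0\<close> off the mesh. As they are given by polynomials on
  the closed simplexes, distinct finite element functions then never agree almost everywhere, and
  the dimension of a finite element space can be computed in the space of all functions.
\<close>

definition piecewise_polynomial ::
    "nat \<Rightarrow> 'a::euclidean_space set set \<Rightarrow> ('a \<Rightarrow> real) \<Rightarrow> bool" where
  "piecewise_polynomial k \<T> f \<longleftrightarrow>
     (\<forall>K\<in>\<T>. \<exists>P. polynomial_of_degree_le k P \<and> (\<forall>x\<in>K. f x = P x)) \<and>
     (\<forall>x. x \<notin> \<Union>\<T> \<longrightarrow> f x = 0)"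

definition finite_element_space ::
    "nat \<Rightarrow> 'a::euclidean_space set set \<Rightarrow> ('a \<Rightarrow> real) set \<Rightarrow> ('a \<Rightarrow> real) set \<Rightarrow> bool" where
  "finite_element_space k \<T> X X\<^sub>h \<longleftrightarrow>
     fun_vs.subspace X\<^sub>h \<and> X\<^sub>h \<subseteq> X \<and> (\<forall>f\<in>X\<^sub>h. piecewise_polynomial k \<T> f)"


section \<open>The critical mesh sizes and the probability laws\<close>

text \<open>
  \<open>A\<close> is the norm of the bilinear form, \<open>\<alpha>\<^sub>h j\<close> the discrete inf-sup constant for degree \<open>j\<close> and
  \<open>S l\<close> the seminorm of order \<open>l\<close> of the solution. Pitfall: for \<open>k + 1 - m - n / p < 0\<close> the
  quantity under the \<open>q\<close>-th root is negative for large \<open>q\<close>, and \<open>powr\<close> then takes the root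
  of its absolute value (\<open>ln (- x) = ln x\<close> in this library).
\<close>

definition h_star ::
    "nat \<Rightarrow> nat \<Rightarrow> real \<Rightarrow> nat \<Rightarrow> real \<Rightarrow> (nat \<Rightarrow> real) \<Rightarrow> (nat \<Rightarrow> real) \<Rightarrow> nat \<Rightarrow> real" where
  "h_star n m p k A \<alpha>\<^sub>h S q =
     ((1 + A / \<alpha>\<^sub>h k) / (1 + A / \<alpha>\<^sub>h (k + q))
      * (real (k + n) / real (k + q + n)) ^ n
      * (real k / real (k + q)) ^ (m * (n + 2))
      * (fact (k + q - m) / fact (k - m))
      * ((real k + real q + 1 - real m - real n / p) / (real k + 1 - real m - real n / p))
      * (S (k + 1) / S (k + q + 1))) powr (1 / real q)"

definition prob_law :: "real \<Rightarrow> nat \<Rightarrow> real \<Rightarrow> real" where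
  "prob_law h\<^sub>s q h =
     (if h \<le> 0 then 0
      else if h \<le> h\<^sub>s then 1 - 1 / 2 * (h / h\<^sub>s) ^ q
      else 1 / 2 * (h\<^sub>s / h) ^ q)"

end

theory Submission
  imports Defs "HOL-Real_Asymp.Real_Asymp"
begin

text \<open>
  Write \<open>X q\<close> for the quantity under the \<open>q\<close>-th root in \<open>h\<^sup>*\<^sub>q\<close>. All its factors but two have ratios
  of consecutive terms that tend to \<open>1\<close>; the quotient of seminorms contributes a finite
  factor \<open>l\<^sub>0\<close>, and the factorial contributes \<open>1 / (k + q + 1 - m)\<close>, which tends to \<open>0\<close>. So
  \<open>X q / X (q + 1)\<close> tends to \<open>0\<close> (\<open>h_star_radicand_ratio\<close>), and therefore, by the ratio test,
  \<open>(t / h\<^sup>*\<^sub>q)\<^sup>q = t\<^sup>q / \<bar>X q\<bar>\<close> tends to \<open>0\<close> for every \<open>t > 0\<close>. In particular \<open>t\<close> eventually lies below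
  \<open>h\<^sup>*\<^sub>q\<close> and \<open>\<P>\<^sub>q(t) = 1 - (t / h\<^sup>*\<^sub>q)\<^sup>q / 2\<close> tends to \<open>1\<close> (\<open>prob_law_tendsto\<close>). As \<open>0 \<le> \<P>\<^sub>q \<le> 1\<close>,
  dominated convergence against a test function yields the limit \<open>T\<^sub>H\<close>, and the functionals in
  question are distributions of order \<open>0\<close> (\<open>prob_laws_converge_weak_star\<close>).

  The argument breaks down if \<open>\<bar>u\<bar>\<^sub>k\<^sub>+\<^sub>1 = 0\<close>, for then \<open>h\<^sup>*\<^sub>q = 0\<close> for all \<open>q\<close>. This is excluded because
  a seminorm that vanishes forces all seminorms of higher order to vanish
  (\<open>sobolev_seminorm_eq_0_mono\<close>), whereas the quotients of consecutive seminorms have the limit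
  \<open>l\<^sub>0 > 0\<close>. Here the weak derivatives entering a seminorm are arbitrarily chosen ones, so their
  uniqueness almost everywhere is needed: it makes them \<open>p\<close>-integrable, so that a vanishing norm
  means vanishing almost everywhere. Uniqueness is the fundamental lemma of the calculus of
  variations, which is reduced to integrals over boxes by smooth approximations of their
  indicator functions.
\<close>

section \<open>Smooth bump functions on boxes\<close>

text \<open>
  The case \<open>k = 0\<close> is the classical function that is smooth and not analytic at \<open>0\<close>. The powers
  of \<open>t\<close> in the denominator make the family closed under differentiation up to linear
  combinations.
\<close>

definition flat :: "nat \<Rightarrow> real \<Rightarrow> real" where
  "flat k t = (if t \<le> 0 then 0 else exp (- 1 / t) / t ^ k)"

lemma flat_tendsto_0: "(flat k \<longlongrightarrow> 0) (at 0)"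
proof -
  have "((\<lambda>t. inverse t ^ k / exp (inverse t)) \<longlongrightarrow> 0) (at_right (0::real))"
    by (rule filterlim_compose[OF tendsto_power_div_exp_0 filterlim_inverse_at_top_right])
  moreover have "\<forall>\<^sub>F t in at_right 0. inverse t ^ k / exp (inverse t) = flat k t"
    by (auto simp: eventually_at_filter flat_def exp_minus field_simps power_inverse)
  ultimately have "(flat k \<longlongrightarrow> 0) (at_right 0)"
    by (rule Lim_transform_eventually)
  moreover have "(flat k \<longlongrightarrow> 0) (at_left 0)"
    by (rule tendsto_eventually) (auto simp: eventually_at_filter flat_def)
  ultimately show ?thesis
    by (simp add: filterlim_at_split)
qed

lemma flat_has_derivative:
  "(flat k has_real_derivative flat (k + 2) t - real k * flat (k + 1) t) (at t)"
proof (cases t "0::real" rule: linorder_cases)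
  case less
  have "((\<lambda>_. 0) has_real_derivative 0) (at t)" by simp
  moreover have "\<forall>\<^sub>F s in nhds t. flat k s = 0"
    using eventually_nhds_in_open[of "{..<0}" t] less
    by (auto elim!: eventually_mono simp: flat_def)
  ultimately show ?thesis
    using less by (subst DERIV_cong_ev[OF refl _ refl]) (auto simp: flat_def)
next
  case equal
  have "((\<lambda>s. (flat k s - flat k 0) / (s - 0)) \<longlongrightarrow> 0) (at 0)"
    by (rule Lim_transform_eventually[OF flat_tendsto_0[of "Suc k"]])
       (auto simp: eventually_at_filter flat_def)
  then show ?thesis
    using equal by (simp add: has_field_derivative_iff flat_def)
next
  case greater
  have "((\<lambda>t. t ^ k) has_real_derivative real k * (t ^ k / t)) (at t)"
    using greater DERIV_pow[of k t] by (cases k) simp_all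
  moreover have "((\<lambda>t. exp (- 1 / t)) has_real_derivative exp (- 1 / t) / t\<^sup>2) (at t)"
    using greater by (auto intro!: derivative_eq_intros simp: power2_eq_square)
  ultimately have "((\<lambda>t. exp (- 1 / t) / t ^ k) has_real_derivative
      (exp (- 1 / t) / t\<^sup>2 * t ^ k - exp (- 1 / t) * (real k * (t ^ k / t))) / (t ^ k * t ^ k)) (at t)"
    using greater by (intro DERIV_divide) auto
  also have "(exp (- 1 / t) / t\<^sup>2 * t ^ k - exp (- 1 / t) * (real k * (t ^ k / t))) / (t ^ k * t ^ k) =
      flat (k + 2) t - real k * flat (k + 1) t"
    using greater by (simp add: flat_def field_simps power2_eq_square)
  finally have "((\<lambda>t. exp (- 1 / t) / t ^ k) has_real_derivative
      flat (k + 2) t - real k * flat (k + 1) t) (at t)" .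
  moreover have "\<forall>\<^sub>F s in nhds t. flat k s = exp (- 1 / s) / s ^ k"
    using eventually_nhds_in_open[of "{0<..}" t] greater
    by (auto elim!: eventually_mono simp: flat_def)
  ultimately show ?thesis
    by (subst DERIV_cong_ev[OF refl _ refl])
qed

text \<open>
  Smoothness asks for differentiability of all iterated partial derivatives. It is immediate for
  the members of a class of differentiable functions that is closed under partial derivatives,
  and this algebra is such a class by the chain rule and the product rule.
\<close>

inductive_set flat_algebra :: "('a::euclidean_space \<Rightarrow> real) set" where
  const: "(\<lambda>x. c) \<in> flat_algebra"
| flat: "(\<lambda>x. flat k (x \<bullet> v + d)) \<in> flat_algebra"
| add: "f \<in> flat_algebra \<Longrightarrow> g \<in> flat_algebra \<Longrightarrow> (\<lambda>x. f x + g x) \<in> flat_algebra"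
| mult: "f \<in> flat_algebra \<Longrightarrow> g \<in> flat_algebra \<Longrightarrow> (\<lambda>x. f x * g x) \<in> flat_algebra"

lemma flat_algebra_differentiable: "f \<in> flat_algebra \<Longrightarrow> f differentiable at x"
proof (induction rule: flat_algebra.induct)
  case (flat k v d)
  have "((\<lambda>x. x \<bullet> v + d) has_derivative (\<lambda>h. h \<bullet> v)) (at x)"
    by (auto intro!: derivative_eq_intros)
  from DERIV_compose_FDERIV[OF flat_has_derivative this] show ?case
    unfolding differentiable_def by blast
qed auto

text \<open>
  The induction carries the existence of the directional derivative along with its membership in
  the algebra, since \<^const>\<open>deriv\<close> obeys the sum and product rules only for differentiable functions.
\<close>

lemma flat_algebra_partial_deriv:
  assumes "f \<in> flat_algebra"
  shows "partial_deriv b f \<in> flat_algebra"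
proof -
  have "\<exists>g\<in>flat_algebra. \<forall>x. ((\<lambda>t. f (x + t *\<^sub>R b)) has_real_derivative g x) (at 0)"
    using assms
  proof induction
    case (const c)
    show ?case by (rule bexI[OF _ flat_algebra.const[of 0]]) auto
  next
    case (flat k v d)
    let ?g = "\<lambda>x. (b \<bullet> v) * (flat (k + 2) (x \<bullet> v + d) + (- real k) * flat (k + 1) (x \<bullet> v + d))"
    have "?g \<in> flat_algebra"
      by (intro flat_algebra.intros)
    moreover have "((\<lambda>t. flat k ((x + t *\<^sub>R b) \<bullet> v + d)) has_real_derivative ?g x) (at 0)" for x
    proof -
      have *: "((\<lambda>t. (x + t *\<^sub>R b) \<bullet> v + d) has_real_derivative b \<bullet> v) (at 0)"
        unfolding inner_add_left inner_scaleR_left by (auto intro!: derivative_eq_intros)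
      show ?thesis
        using DERIV_chain2[OF flat_has_derivative[of k "(x + 0 *\<^sub>R b) \<bullet> v + d"] *]
        by (simp add: algebra_simps)
    qed
    ultimately show ?case by (intro bexI[of _ ?g]) auto
  next
    case (add f g)
    then obtain f' g' where "f' \<in> flat_algebra" "g' \<in> flat_algebra"
      and "\<And>x. ((\<lambda>t. f (x + t *\<^sub>R b)) has_real_derivative f' x) (at 0)"
      and "\<And>x. ((\<lambda>t. g (x + t *\<^sub>R b)) has_real_derivative g' x) (at 0)" by blast
    then show ?case
      by (intro bexI[of _ "\<lambda>x. f' x + g' x"]) (auto intro!: derivative_intros flat_algebra.add)
  next
    case (mult f g)
    then obtain f' g' where f': "f' \<in> flat_algebra" "g' \<in> flat_algebra"
      and d: "\<And>x. ((\<lambda>t. f (x + t *\<^sub>R b)) has_real_derivative f' x) (at 0)"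
        "\<And>x. ((\<lambda>t. g (x + t *\<^sub>R b)) has_real_derivative g' x) (at 0)" by blast
    have "(\<lambda>x. f' x * g x + g' x * f x) \<in> flat_algebra" (is "?h \<in> _")
      using mult.hyps f' by (intro flat_algebra.add flat_algebra.mult)
    moreover have "((\<lambda>t. f (x + t *\<^sub>R b) * g (x + t *\<^sub>R b)) has_real_derivative
        (f' x * g x + g' x * f x)) (at 0)" for x
      using DERIV_mult[OF d(1)[of x] d(2)[of x]] by simp
    ultimately show ?case by (intro bexI[of _ ?h]) auto
  qed
  then obtain g where "g \<in> flat_algebra"
    and "\<And>x. ((\<lambda>t. f (x + t *\<^sub>R b)) has_real_derivative g x) (at 0)" by blast
  then have "partial_deriv b f = g"
    by (auto simp: fun_eq_iff partial_deriv_def intro: DERIV_imp_deriv)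
  with \<open>g \<in> flat_algebra\<close> show ?thesis by simp
qed

lemma flat_algebra_smooth:
  assumes "f \<in> flat_algebra"
  shows "smooth f"
proof -
  have "partial_derivs bs f \<in> flat_algebra" for bs
    using assms by (induction bs) (auto intro: flat_algebra_partial_deriv)
  then show ?thesis
    by (simp add: smooth_def flat_algebra_differentiable)
qed

lemma flat_algebra_prod:
  assumes "finite I" and "\<And>i. i \<in> I \<Longrightarrow> f i \<in> flat_algebra"
  shows "(\<lambda>x. \<Prod>i\<in>I. f i x) \<in> flat_algebra"
  using assms by (induction I) (auto intro: flat_algebra.intros)

text \<open>
  Each factor \<open>exp (- 1 / (N t))\<close> with \<open>t > 0\<close> increases to \<open>1\<close> as \<open>N\<close> grows, so these functions
  approximate the indicator function of \<open>box a b\<close> pointwise from below.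
\<close>

definition box_bump :: "'a::euclidean_space \<Rightarrow> 'a \<Rightarrow> nat \<Rightarrow> 'a \<Rightarrow> real" where
  "box_bump a b N x = (\<Prod>e\<in>Basis. flat 0 (real N * (x \<bullet> e - a \<bullet> e)) * flat 0 (real N * (b \<bullet> e - x \<bullet> e)))"

lemma flat_0_bounds: "0 \<le> flat 0 t" "flat 0 t \<le> 1"
  by (auto simp: flat_def)

lemma box_bump_bounds: "0 \<le> box_bump a b N x" "box_bump a b N x \<le> 1"
  unfolding box_bump_def
  by (auto intro!: prod_nonneg prod_le_1 mult_nonneg_nonneg mult_le_one flat_0_bounds)

lemma box_bump_outside: "x \<notin> box a b \<Longrightarrow> box_bump a b N x = 0"
  by (fastforce simp: box_bump_def mem_box flat_def not_less mult_le_0_iff)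

lemma box_bump_tendsto:
  "(\<lambda>N. box_bump a b N x) \<longlonglongrightarrow> indicator (box a b) x"
proof (cases "x \<in> box a b")
  case True
  have flat_lim: "(\<lambda>N. flat 0 (real N * t)) \<longlonglongrightarrow> 1" if "t > 0" for t
  proof -
    have "(\<lambda>N. exp (- (1 / t) * (1 / real N))) \<longlonglongrightarrow> exp (- (1 / t) * 0)"
      by (intro tendsto_intros lim_1_over_n)
    moreover have "\<forall>\<^sub>F N in sequentially. exp (- (1 / t) * (1 / real N)) = flat 0 (real N * t)"
      using eventually_gt_at_top[of "0::nat"]
      by eventually_elim (use that in \<open>auto simp: flat_def mult_le_0_iff\<close>)
    ultimately show ?thesis
      by (auto intro: Lim_transform_eventually)
  qed
  have "(\<lambda>N. box_bump a b N x) \<longlonglongrightarrow> (\<Prod>e\<in>(Basis::'a set). 1 * 1)"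
    unfolding box_bump_def using True by (intro tendsto_intros flat_lim) (auto simp: mem_box)
  then show ?thesis using True by simp
qed (simp add: box_bump_outside)

lemma box_bump_test_function:
  assumes "cbox a b \<subseteq> \<Omega>"
  shows "box_bump a b N \<in> test_functions \<Omega>"
proof -
  have eq: "box_bump a b N = (\<lambda>x. \<Prod>e\<in>Basis.
      flat 0 (x \<bullet> (real N *\<^sub>R e) + - real N * (a \<bullet> e)) *
      flat 0 (x \<bullet> (- real N *\<^sub>R e) + real N * (b \<bullet> e)))"
    by (simp add: fun_eq_iff box_bump_def algebra_simps)
  have "smooth (box_bump a b N)"
    \<comment> \<open>In this form each factor is literally a generator of the algebra.\<close>
    unfolding eq
    by (intro flat_algebra_smooth flat_algebra_prod flat_algebra.mult flat_algebra.flat) auto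
  moreover have "\<forall>x. x \<notin> cbox a b \<longrightarrow> box_bump a b N x = 0"
    using box_bump_outside box_subset_cbox by blast
  ultimately show ?thesis
    using assms compact_cbox unfolding test_functions_def by blast
qed

section \<open>The fundamental lemma of the calculus of variations\<close>

lemma AE_cbox_iff_box: "AE x in lebesgue. x \<in> cbox a b \<longleftrightarrow> x \<in> box a b"
proof -
  have "cbox a b - box a b \<in> null_sets lebesgue"
    using negligible_frontier_interval negligible_iff_null_sets by blast
  then show ?thesis
    by (rule AE_I') (use box_subset_cbox[of a b] in auto)
qed

text \<open>
  Boxes form an intersection-stable generator of the Borel sets, so by Dynkin's argument all Borel
  integrals of \<open>g\<close> vanish. The support condition supplies the vanishing of the total integral,
  on which the step to complements depends.
\<close>

lemma AE_zero_if_box_integrals_zero: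
  fixes g :: "'a::euclidean_space \<Rightarrow> real"
  assumes g: "integrable lebesgue g"
    and supp: "\<And>x. x \<notin> cbox c d \<Longrightarrow> g x = 0"
    and box: "\<And>a b. (LINT x:box a b|lebesgue. g x) = 0"
  shows "AE x in lebesgue. g x = 0"
proof -
  \<comment> \<open>Dynkin's argument takes place on Borel sets, so \<open>g\<close> is first replaced by a Borel version.\<close>
  obtain g' where g'[measurable]: "g' \<in> borel_measurable lborel"
    and eq: "AE x in lborel. g x = g' x"
    using completion_ex_borel_measurable_real[of g lborel] g by auto
  have eq': "AE x in lebesgue. g x = g' x"
    using eq by (rule AE_completion)
  have int': "integrable lborel g'"
  proof -
    have "integrable lebesgue g'"
      using integrable_cong_AE_imp[OF g measurable_completion[OF g'], of] eq'
      by (simp add: eq_commute)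
    then show ?thesis by (simp add: integrable_completion)
  qed
  have eq_int: "(LINT x:A|lborel. g' x) = (LINT x:A|lebesgue. g x)" if [measurable]: "A \<in> sets borel" for A
  proof -
    have "(LINT x:A|lborel. g' x) = (LINT x:A|lebesgue. g' x)"
      unfolding set_lebesgue_integral_def by (rule integral_completion[symmetric]) measurable
    also have "\<dots> = (LINT x:A|lebesgue. g x)"
      unfolding set_lebesgue_integral_def
    proof (rule integral_cong_AE)
      show "(\<lambda>x. indicator A x *\<^sub>R g' x) \<in> borel_measurable lebesgue"
        by (intro measurable_completion) measurable
      show "(\<lambda>x. indicator A x *\<^sub>R g x) \<in> borel_measurable lebesgue"
        using borel_measurable_integrable[OF g]
        by (intro borel_measurable_scaleR borel_measurable_indicator sets_completionI_sets) auto
      show "AE x in lebesgue. indicator A x *\<^sub>R g' x = indicator A x *\<^sub>R g x"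
        using eq' by eventually_elim simp
    qed
    finally show ?thesis .
  qed
  have total: "(LINT x|lborel. g' x) = 0"
  proof -
    have "(LINT x|lborel. g' x) = (LINT x:UNIV|lebesgue. g x)"
      using eq_int[of UNIV] by (simp add: set_lebesgue_integral_def)
    also have "\<dots> = (LINT x:box c d|lebesgue. g x)"
      unfolding set_lebesgue_integral_def
    proof (rule integral_cong_AE)
      show "AE x in lebesgue. indicator UNIV x *\<^sub>R g x = indicator (box c d) x *\<^sub>R g x"
        using AE_cbox_iff_box[of c d] by eventually_elim (use supp in \<open>auto simp: indicator_def\<close>)
      show "(\<lambda>x. indicator (box c d) x *\<^sub>R g x) \<in> borel_measurable lebesgue"
        using borel_measurable_integrable[OF g]
        by (intro borel_measurable_scaleR borel_measurable_indicator sets_completionI_sets) auto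
    qed (use g in auto)
    finally show ?thesis using box by simp
  qed
  have zero: "(LINT x:A|lborel. g' x) = 0" if "A \<in> sets borel" for A
  proof -
    let ?G = "range (\<lambda>(a, b). box a b :: 'a set)"
    have sets: "sigma_sets UNIV ?G = sets borel"
      by (subst borel_eq_box) simp
    have "Int_stable ?G"
      by (auto simp: Int_stable_def box_Int_box)
    moreover have "?G \<subseteq> Pow UNIV" by simp
    moreover have "A \<in> sigma_sets UNIV ?G"
      using that sets by simp
    ultimately show ?thesis
    proof (induction rule: sigma_sets_induct_disjoint)
      case (basic A)
      then show ?case using eq_int box by auto
    next
      case empty
      show ?case by (simp add: set_lebesgue_integral_def)
    next
      case (compl A)
      then have A: "A \<in> sets borel" using sets by simp
      have "(LINT x:(UNIV - A) \<union> A|lborel. g' x) =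
          (LINT x:UNIV - A|lborel. g' x) + (LINT x:A|lborel. g' x)"
      proof (rule set_integral_Un)
        show "set_integrable lborel (UNIV - A) g'" "set_integrable lborel A g'"
          unfolding set_integrable_def using A int' by (auto intro!: integrable_mult_indicator simp del: real_scaleR_def)
      qed auto
      then show ?case using compl total
        by (simp add: set_lebesgue_integral_def)
    next
      case (union A)
      then have A: "A i \<in> sets borel" for i using sets by auto
      have "(LINT x:(\<Union>i. A i)|lborel. g' x) = (\<Sum>i. (LINT x:(A i)|lborel. g' x))"
        using A int' union(1)
        by (intro lebesgue_integral_countable_add)
           (auto simp: set_integrable_def disjoint_family_on_def
             simp del: real_scaleR_def intro!: integrable_mult_indicator)
      then show ?case using union by simp
    qed
  qed
  have "AE x in lborel. g' x = 0"
    by (rule sigma_finite_measure.density_zero[OF lborel.sigma_finite_measure_axioms int']) (use zero in auto)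
  then have "AE x in lebesgue. g' x = 0"
    by (rule AE_completion)
  with eq' show ?thesis by eventually_elim simp
qed

lemma test_function_continuous:
  assumes "\<phi> \<in> test_functions \<Omega>"
  shows "continuous_on UNIV \<phi>"
proof -
  have "partial_derivs [] \<phi> differentiable at x" for x
    using assms unfolding test_functions_def smooth_def by blast
  then show ?thesis
    by (auto intro!: continuous_at_imp_continuous_on differentiable_imp_continuous_within)
qed

lemma test_function_measurable:
  assumes "\<phi> \<in> test_functions \<Omega>"
  shows "\<phi> \<in> borel_measurable lebesgue"
  by (intro measurable_completion)
     (simp add: borel_measurable_continuous_onI test_function_continuous[OF assms])

lemma test_function_bounded:
  assumes "\<phi> \<in> test_functions \<Omega>"
  obtains B where "\<And>x. \<bar>\<phi> x\<bar> \<le> B"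
proof -
  obtain K where K: "compact K" "\<And>x. x \<notin> K \<Longrightarrow> \<phi> x = 0"
    using assms by (auto simp: test_functions_def)
  have "compact (\<phi> ` K)"
    using compact_continuous_image[OF continuous_on_subset[OF test_function_continuous[OF assms]] K(1)] by simp
  then have "bounded (\<phi> ` K)" by (rule compact_imp_bounded)
  then obtain B where B: "B > 0" "\<And>x. x \<in> K \<Longrightarrow> \<bar>\<phi> x\<bar> \<le> B"
    unfolding bounded_pos by auto
  have "\<bar>\<phi> x\<bar> \<le> B" for x
    using B K(2) by (cases "x \<in> K") auto
  then show ?thesis using that by blast
qed

lemma set_integrable_times_test_function:
  assumes f: "locally_integrable \<Omega> f" and \<phi>: "\<phi> \<in> test_functions \<Omega>"
  shows "set_integrable lebesgue \<Omega> (\<lambda>x. f x * \<phi> x)"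
proof -
  obtain K where K: "compact K" "K \<subseteq> \<Omega>" "\<And>x. x \<notin> K \<Longrightarrow> \<phi> x = 0"
    using \<phi> by (auto simp: test_functions_def)
  obtain B where B: "\<And>x. \<bar>\<phi> x\<bar> \<le> B" using test_function_bounded[OF \<phi>] by metis
  have fK: "integrable lebesgue (\<lambda>x. indicator K x *\<^sub>R f x)"
    using f K by (auto simp: locally_integrable_def set_integrable_def)
  have "integrable lebesgue (\<lambda>x. (indicator K x *\<^sub>R f x) * \<phi> x)"
  proof (rule Bochner_Integration.integrable_bound)
    show "integrable lebesgue (\<lambda>x. B * (indicator K x *\<^sub>R f x))"
      using fK by (rule integrable_mult_right)
    show "(\<lambda>x. (indicator K x *\<^sub>R f x) * \<phi> x) \<in> borel_measurable lebesgue"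
      using borel_measurable_integrable[OF fK] test_function_measurable[OF \<phi>]
      by (rule borel_measurable_times)
    have "\<bar>(indicator K x *\<^sub>R f x) * \<phi> x\<bar> \<le> \<bar>B * (indicator K x *\<^sub>R f x)\<bar>" for x
    proof -
      have "\<bar>indicator K x * f x\<bar> * \<bar>\<phi> x\<bar> \<le> \<bar>indicator K x * f x\<bar> * \<bar>B\<bar>"
        using B[of x] by (intro mult_left_mono) auto
      then show ?thesis by (simp add: abs_mult mult_ac)
    qed
    then show "AE x in lebesgue. norm ((indicator K x *\<^sub>R f x) * \<phi> x) \<le> norm (B * (indicator K x *\<^sub>R f x))"
      by simp
  qed
  also have "(\<lambda>x. (indicator K x *\<^sub>R f x) * \<phi> x) = (\<lambda>x. indicator \<Omega> x *\<^sub>R (f x * \<phi> x))"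
    using K by (auto simp: fun_eq_iff indicator_def)
  finally show ?thesis by (simp add: set_integrable_def)
qed

text \<open>
  The bump functions of the box are admissible test functions because their supports lie in
  \<open>cbox a b\<close>, and dominated convergence carries the hypothesis over to their limit, the indicator
  function of the box.
\<close>

lemma box_integral_zero:
  assumes f: "locally_integrable \<Omega> f"
    and zero: "\<And>\<phi>. \<phi> \<in> test_functions \<Omega> \<Longrightarrow> (LINT x:\<Omega>|lebesgue. f x * \<phi> x) = 0"
    and sub: "cbox a b \<subseteq> \<Omega>"
  shows "(LINT x:box a b|lebesgue. f x) = 0"
proof -
  have int: "integrable lebesgue (\<lambda>x. indicator (cbox a b) x *\<^sub>R f x)"
    using f sub by (auto simp: locally_integrable_def set_integrable_def)
  have box_cbox: "box a b \<subseteq> cbox a b" by (rule box_subset_cbox)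
  have test: "box_bump a b N \<in> test_functions \<Omega>" for N
    using sub by (rule box_bump_test_function)
  have "(\<lambda>N. LINT x|lebesgue. indicator \<Omega> x *\<^sub>R (f x * box_bump a b N x)) \<longlonglongrightarrow>
      (LINT x|lebesgue. indicator (box a b) x *\<^sub>R f x)"
  proof (rule integral_dominated_convergence)
    show "integrable lebesgue (\<lambda>x. norm (indicator (cbox a b) x *\<^sub>R f x))"
      using int by (rule integrable_norm)
    have "(\<lambda>x. indicator (box a b) x * (indicator (cbox a b) x *\<^sub>R f x)) \<in> borel_measurable lebesgue"
      using borel_measurable_integrable[OF int]
      by (intro borel_measurable_times borel_measurable_indicator sets_completionI_sets) auto
    also have "(\<lambda>x. indicator (box a b) x * (indicator (cbox a b) x *\<^sub>R f x)) =
        (\<lambda>x. indicator (box a b) x *\<^sub>R f x)"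
      using box_cbox by (auto simp: fun_eq_iff indicator_def)
    finally show "(\<lambda>x. indicator (box a b) x *\<^sub>R f x) \<in> borel_measurable lebesgue" .
    show "(\<lambda>x. indicator \<Omega> x *\<^sub>R (f x * box_bump a b N x)) \<in> borel_measurable lebesgue" for N
      using set_integrable_times_test_function[OF f test]
      by (auto simp: set_integrable_def)
    have ind: "indicator \<Omega> x *\<^sub>R (f x * box_bump a b N x) = f x * box_bump a b N x" for N x
      using sub box_cbox box_bump_outside[of x a b N] by (auto simp: indicator_def)
    have "(\<lambda>N. f x * box_bump a b N x) \<longlonglongrightarrow> f x * indicator (box a b) x" for x
      by (intro tendsto_intros box_bump_tendsto)
    then show "AE x in lebesgue. (\<lambda>N. indicator \<Omega> x *\<^sub>R (f x * box_bump a b N x)) \<longlonglongrightarrow>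
        indicator (box a b) x *\<^sub>R f x"
      unfolding ind by (simp add: mult.commute)
    have "\<bar>f x * box_bump a b N x\<bar> \<le> \<bar>indicator (cbox a b) x * f x\<bar>" for N x
    proof (cases "x \<in> box a b")
      case True
      then have "\<bar>f x\<bar> * \<bar>box_bump a b N x\<bar> \<le> \<bar>f x\<bar> * 1"
        using box_bump_bounds[of a b N x] by (intro mult_left_mono) auto
      with True box_cbox show ?thesis by (auto simp: abs_mult)
    qed (simp add: box_bump_outside)
    then show "AE x in lebesgue. norm (indicator \<Omega> x *\<^sub>R (f x * box_bump a b N x)) \<le>
        norm (indicator (cbox a b) x *\<^sub>R f x)" for N
      unfolding ind by simp
  qed
  moreover have "(LINT x|lebesgue. indicator \<Omega> x *\<^sub>R (f x * box_bump a b N x)) = 0" for N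
    using zero[OF test] by (simp add: set_lebesgue_integral_def)
  ultimately show ?thesis
    by (simp add: set_lebesgue_integral_def LIMSEQ_const_iff)
qed

text \<open>
  It suffices to work on each of countably many closed boxes that cover \<open>\<Omega>\<close>. On such a box \<open>f\<close> is
  integrable, and cutting \<open>f\<close> off outside it leaves all integrals over boxes equal to \<open>0\<close>, as the
  intersection of two open boxes is an open box.
\<close>

lemma fundamental_lemma_calculus_of_variations:
  assumes "open \<Omega>" and f: "locally_integrable \<Omega> f"
    and zero: "\<And>\<phi>. \<phi> \<in> test_functions \<Omega> \<Longrightarrow> (LINT x:\<Omega>|lebesgue. f x * \<phi> x) = 0"
  shows "zero_on \<Omega> f"
proof -
  have on_box: "AE x in lebesgue. x \<in> cbox c d \<longrightarrow> f x = 0" if sub: "cbox c d \<subseteq> \<Omega>" for c d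
  proof -
    have int: "integrable lebesgue (\<lambda>x. indicator (cbox c d) x *\<^sub>R f x)"
      using f sub by (auto simp: locally_integrable_def set_integrable_def)
    then have "AE x in lebesgue. indicator (cbox c d) x *\<^sub>R f x = 0"
    proof (rule AE_zero_if_box_integrals_zero)
      show "indicator (cbox c d) x *\<^sub>R f x = 0" if "x \<notin> cbox c d" for x
        using that by simp
      show "(LINT x:box a b|lebesgue. indicator (cbox c d) x *\<^sub>R f x) = 0" for a b
      proof -
        obtain a' b' where box: "box a b \<inter> box c d = box a' b'"
          by (rule that[OF box_Int_box])
        have "(LINT x:box a b|lebesgue. indicator (cbox c d) x *\<^sub>R f x) =
            (LINT x:box a b \<inter> box c d|lebesgue. f x)"
          unfolding set_lebesgue_integral_def
        proof (rule integral_cong_AE)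
          have meas: "(\<lambda>x. indicator (cbox c d) x *\<^sub>R f x) \<in> borel_measurable lebesgue"
            using int by (rule borel_measurable_integrable)
          show "(\<lambda>x. indicator (box a b) x *\<^sub>R (indicator (cbox c d) x *\<^sub>R f x)) \<in> borel_measurable lebesgue"
            by (rule borel_measurable_scaleR[OF _ meas])
               (intro borel_measurable_indicator sets_completionI_sets, simp)
          have "(\<lambda>x. indicator (box a b \<inter> box c d) x *\<^sub>R (indicator (cbox c d) x *\<^sub>R f x)) \<in> borel_measurable lebesgue"
            by (rule borel_measurable_scaleR[OF _ meas])
               (intro borel_measurable_indicator sets_completionI_sets, simp)
          also have "(\<lambda>x. indicator (box a b \<inter> box c d) x *\<^sub>R (indicator (cbox c d) x *\<^sub>R f x)) =
              (\<lambda>x. indicator (box a b \<inter> box c d) x *\<^sub>R f x)"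
            using box_subset_cbox[of c d] by (auto simp: fun_eq_iff indicator_def)
          finally show "(\<lambda>x. indicator (box a b \<inter> box c d) x *\<^sub>R f x) \<in> borel_measurable lebesgue" .
          show "AE x in lebesgue. indicator (box a b) x *\<^sub>R (indicator (cbox c d) x *\<^sub>R f x) =
              indicator (box a b \<inter> box c d) x *\<^sub>R f x"
            using AE_cbox_iff_box[of c d] by eventually_elim (auto simp: indicator_def)
        qed
        also have "\<dots> = 0"
        proof (cases "box a' b' = {}")
          case False
          then have "cbox a' b' = closure (box a b \<inter> box c d)" by (simp add: box closure_box)
          also have "\<dots> \<subseteq> closure (box c d)" by (intro closure_mono) auto
          also have "\<dots> \<subseteq> cbox c d" by (intro closure_minimal box_subset_cbox closed_cbox)
          finally show ?thesis
            unfolding box using sub by (intro box_integral_zero[OF f zero]) auto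
        qed (simp add: box set_lebesgue_integral_def)
        finally show ?thesis .
      qed
    qed
    then show ?thesis by eventually_elim (auto simp: indicator_def split: if_splits)
  qed
  obtain \<D> where \<D>: "countable \<D>" "\<D> \<subseteq> Pow \<Omega>" "\<And>X. X \<in> \<D> \<Longrightarrow> \<exists>a b. X = cbox a b" "\<Union>\<D> = \<Omega>"
    by (rule open_countable_Union_open_cbox[OF \<open>open \<Omega>\<close>]) blast
  have "AE x in lebesgue. \<forall>X\<in>\<D>. x \<in> X \<longrightarrow> f x = 0"
  proof (subst AE_ball_countable[OF \<D>(1)], intro ballI)
    fix X assume "X \<in> \<D>"
    then obtain a b where "X = cbox a b" "X \<subseteq> \<Omega>" using \<D> by blast
    then show "AE x in lebesgue. x \<in> X \<longrightarrow> f x = 0" using on_box by simp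
  qed
  then show ?thesis
    unfolding zero_on_def using \<D>(4) by (auto elim: eventually_mono)
qed

section \<open>Vanishing of Sobolev seminorms\<close>

lemma finite_multi_indices: "finite (multi_indices l :: ('a::euclidean_space \<Rightarrow> nat) set)"
proof (rule finite_subset)
  show "multi_indices l \<subseteq> {\<alpha>. \<forall>b::'a. (b \<in> Basis \<longrightarrow> \<alpha> b \<in> {..l}) \<and> (b \<notin> Basis \<longrightarrow> \<alpha> b = 0)}"
  proof
    fix \<alpha> :: "'a \<Rightarrow> nat" assume \<alpha>: "\<alpha> \<in> multi_indices l"
    then have "\<alpha> b \<le> l" if "b \<in> Basis" for b
      using member_le_sum[of b Basis \<alpha>] that by (simp add: multi_indices_def)
    with \<alpha> show "\<alpha> \<in> {\<alpha>. \<forall>b::'a. (b \<in> Basis \<longrightarrow> \<alpha> b \<in> {..l}) \<and> (b \<notin> Basis \<longrightarrow> \<alpha> b = 0)}"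
      by (simp add: multi_indices_def)
  qed
  show "finite {\<alpha>. \<forall>b::'a. (b \<in> Basis \<longrightarrow> \<alpha> b \<in> {..l}) \<and> (b \<notin> Basis \<longrightarrow> \<alpha> b = (0::nat))}"
    by (intro finite_set_of_finite_funs) auto
qed

lemma multi_indices_Suc_decompose:
  fixes \<beta> :: "'a::euclidean_space \<Rightarrow> nat"
  assumes "\<beta> \<in> multi_indices (Suc l)"
  obtains b \<alpha> where "b \<in> Basis" "\<alpha> \<in> multi_indices l" "\<beta> = \<alpha>(b := Suc (\<alpha> b))"
proof -
  have sum: "sum \<beta> Basis = Suc l" and out: "\<And>b. b \<notin> Basis \<Longrightarrow> \<beta> b = 0"
    using assms by (auto simp: multi_indices_def)
  have "\<not> (\<forall>b\<in>Basis. \<beta> b = 0)"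
  proof
    assume "\<forall>b\<in>Basis. \<beta> b = 0"
    then have "sum \<beta> Basis = 0" by (rule sum.neutral)
    with sum show False by simp
  qed
  then obtain b where b: "b \<in> Basis" "\<beta> b \<noteq> 0" by blast
  let ?\<alpha> = "\<beta>(b := \<beta> b - 1)"
  have "sum \<beta> Basis = \<beta> b + sum \<beta> (Basis - {b})"
    using b by (simp add: sum.remove)
  moreover have "sum ?\<alpha> Basis = (\<beta> b - 1) + sum \<beta> (Basis - {b})"
    using b by (simp add: sum.remove)
  ultimately have "?\<alpha> \<in> multi_indices l"
    using sum out b by (auto simp: multi_indices_def)
  moreover have "\<beta> = ?\<alpha>(b := Suc (?\<alpha> b))"
    using b by auto
  ultimately show ?thesis using that b(1) by blast
qed

text \<open>
  The definition of a weak derivative quantifies over the lists that realise a multi-index; without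
  such a list it would say nothing.
\<close>

lemma multi_index_list:
  "\<alpha> \<in> multi_indices l \<Longrightarrow> \<exists>bs. \<forall>b. count_list bs b = \<alpha> b"
proof (induction l arbitrary: \<alpha>)
  case 0
  then have "\<alpha> b = 0" for b
    by (cases "b \<in> Basis") (simp_all add: multi_indices_def)
  then show ?case by (intro exI[of _ "[]"]) simp
next
  case (Suc l)
  obtain b \<alpha>' where "b \<in> Basis" and \<alpha>': "\<alpha>' \<in> multi_indices l" and eq: "\<alpha> = \<alpha>'(b := Suc (\<alpha>' b))"
    using that by (rule multi_indices_Suc_decompose[OF Suc.prems])
  from Suc.IH[OF \<alpha>'] obtain bs where "\<forall>c. count_list bs c = \<alpha>' c" ..
  then have "\<forall>c. count_list (b # bs) c = \<alpha> c" by (simp add: eq)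
  then show ?case ..
qed

lemma partial_derivs_append: "partial_derivs (bs @ cs) f = partial_derivs bs (partial_derivs cs f)"
  by (induction bs) auto

lemma partial_deriv_test_function:
  assumes "\<phi> \<in> test_functions \<Omega>" and "b \<in> Basis"
  shows "partial_deriv b \<phi> \<in> test_functions \<Omega>"
proof -
  obtain K where K: "compact K" "K \<subseteq> \<Omega>" "\<And>x. x \<notin> K \<Longrightarrow> \<phi> x = 0" and smooth: "smooth \<phi>"
    using assms(1) by (auto simp: test_functions_def)
  have "partial_derivs bs (partial_deriv b \<phi>) differentiable at x" if "bs \<in> lists Basis" for bs x
  proof -
    have "bs @ [b] \<in> lists Basis" using that assms(2) by simp
    then have "partial_derivs (bs @ [b]) \<phi> differentiable at x"
      using smooth unfolding smooth_def by blast
    then show ?thesis by (simp add: partial_derivs_append)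
  qed
  then have "smooth (partial_deriv b \<phi>)"
    unfolding smooth_def by blast
  moreover have "partial_deriv b \<phi> x = 0" if "x \<notin> K" for x
  proof -
    let ?U = "(\<lambda>t. x + t *\<^sub>R b) -` (- K)"
    have "open (- K)"
      using compact_imp_closed[OF K(1)] by (rule open_Compl)
    then have "open ?U"
      by (rule open_vimage) (intro continuous_intros)
    moreover have "0 \<in> ?U" using that by simp
    ultimately have "\<forall>\<^sub>F t in nhds 0. t \<in> ?U"
      by (rule eventually_nhds_in_open)
    then have "\<forall>\<^sub>F t in nhds 0. \<phi> (x + t *\<^sub>R b) = 0"
      by eventually_elim (rule K(3), simp)
    then show ?thesis
      unfolding partial_deriv_def by (subst deriv_cong_ev[OF _ refl, where g = "\<lambda>_. 0"]) auto
  qed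
  ultimately show ?thesis
    using K unfolding test_functions_def by blast
qed

lemma weak_derivD:
  assumes "weak_deriv \<Omega> \<alpha> u g" and "\<phi> \<in> test_functions \<Omega>" and "\<forall>b. count_list bs b = \<alpha> b"
  shows "(LINT x:\<Omega>|lebesgue. u x * partial_derivs bs \<phi> x) =
    (-1) ^ length bs * (LINT x:\<Omega>|lebesgue. g x * \<phi> x)"
  using assms unfolding weak_deriv_def by simp

text \<open>
  Both weak derivatives have the same pairing with every test function, namely, up to sign, that of
  \<open>u\<close> with an iterated partial derivative of the test function.
\<close>

lemma weak_deriv_unique:
  assumes "open \<Omega>" and \<alpha>: "\<alpha> \<in> multi_indices l"
    and g: "weak_deriv \<Omega> \<alpha> u g" and g': "weak_deriv \<Omega> \<alpha> u g'"
  shows "zero_on \<Omega> (\<lambda>x. g x - g' x)"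
proof (rule fundamental_lemma_calculus_of_variations[OF \<open>open \<Omega>\<close>])
  obtain bs where bs: "\<forall>b. count_list bs b = \<alpha> b"
    using multi_index_list[OF \<alpha>] by blast
  have loc: "locally_integrable \<Omega> g" "locally_integrable \<Omega> g'"
    using g g' by (auto simp: weak_deriv_def)
  then show "locally_integrable \<Omega> (\<lambda>x. g x - g' x)"
    by (auto simp: locally_integrable_def)
  fix \<phi> assume \<phi>: "\<phi> \<in> test_functions \<Omega>"
  have "(-1) ^ length bs * (LINT x:\<Omega>|lebesgue. g x * \<phi> x) =
      (-1) ^ length bs * (LINT x:\<Omega>|lebesgue. g' x * \<phi> x)"
    using weak_derivD[OF g \<phi> bs] weak_derivD[OF g' \<phi> bs] by simp
  then have "(LINT x:\<Omega>|lebesgue. g x * \<phi> x) = (LINT x:\<Omega>|lebesgue. g' x * \<phi> x)"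
    by simp
  then show "(LINT x:\<Omega>|lebesgue. (g x - g' x) * \<phi> x) = 0"
    using loc[THEN set_integrable_times_test_function, OF \<phi>] by (simp add: left_diff_distrib)
qed

text \<open>
  Moving the derivative \<open>\<partial>\<^sub>b\<close> to the test function turns the pairing that defines \<open>g\<close> into the one that
  defines \<open>f\<close>, namely against \<open>\<partial>\<^sub>b \<phi>\<close>, which is again a test function.
\<close>

lemma weak_deriv_Suc_zero:
  assumes "open \<Omega>" and b: "b \<in> Basis" and \<alpha>: "\<alpha> \<in> multi_indices l"
    and f: "weak_deriv \<Omega> \<alpha> u f" and zero: "zero_on \<Omega> f"
    and g: "weak_deriv \<Omega> (\<alpha>(b := Suc (\<alpha> b))) u g"
  shows "zero_on \<Omega> g"
proof (rule fundamental_lemma_calculus_of_variations[OF \<open>open \<Omega>\<close>])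
  obtain bs where bs: "\<forall>b. count_list bs b = \<alpha> b"
    using multi_index_list[OF \<alpha>] by blast
  then have bs': "\<forall>c. count_list (bs @ [b]) c = (\<alpha>(b := Suc (\<alpha> b))) c"
    by simp
  show "locally_integrable \<Omega> g"
    using g by (auto simp: weak_deriv_def)
  fix \<phi> assume \<phi>: "\<phi> \<in> test_functions \<Omega>"
  let ?\<psi> = "partial_deriv b \<phi>"
  have "(LINT x:\<Omega>|lebesgue. u x * partial_derivs bs ?\<psi> x) =
      (-1) ^ length bs * (LINT x:\<Omega>|lebesgue. f x * ?\<psi> x)"
    by (rule weak_derivD[OF f partial_deriv_test_function[OF \<phi> b] bs])
  also have "(LINT x:\<Omega>|lebesgue. f x * ?\<psi> x) = 0"
    unfolding set_lebesgue_integral_def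
  proof (rule integral_eq_zero_AE)
    show "AE x in lebesgue. indicator \<Omega> x *\<^sub>R (f x * ?\<psi> x) = 0"
      using zero unfolding zero_on_def by eventually_elim (auto simp: indicator_def)
  qed
  finally have "(LINT x:\<Omega>|lebesgue. u x * partial_derivs (bs @ [b]) \<phi> x) = 0"
    by (simp add: partial_derivs_append)
  moreover have "(LINT x:\<Omega>|lebesgue. u x * partial_derivs (bs @ [b]) \<phi> x) =
      (-1) ^ length (bs @ [b]) * (LINT x:\<Omega>|lebesgue. g x * \<phi> x)"
    by (rule weak_derivD[OF g \<phi> bs'])
  ultimately show "(LINT x:\<Omega>|lebesgue. g x * \<phi> x) = 0"
    by simp
qed

lemma Lp_norm_zero_on:
  assumes "zero_on \<Omega> f"
  shows "Lp_norm p \<Omega> f = 0"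
proof -
  have "AE x in lebesgue. indicator \<Omega> x *\<^sub>R \<bar>f x\<bar> powr p = 0"
    using assms unfolding zero_on_def by eventually_elim (auto simp: indicator_def)
  then have "(LINT x:\<Omega>|lebesgue. \<bar>f x\<bar> powr p) = 0"
    unfolding set_lebesgue_integral_def by (rule integral_eq_zero_AE)
  then show ?thesis
    unfolding Lp_norm_def by simp
qed

lemma sobolev_obtains_weak_deriv:
  assumes "u \<in> sobolev l p \<Omega>" and "\<alpha> \<in> multi_indices l"
  obtains g where "g \<in> Lp_on p \<Omega>" "weak_deriv \<Omega> \<alpha> u g"
proof -
  have "\<forall>j\<le>l. \<forall>\<alpha>\<in>multi_indices j. \<exists>g\<in>Lp_on p \<Omega>. weak_deriv \<Omega> \<alpha> u g"
    using assms(1) unfolding sobolev_def mem_Collect_eq .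
  from this[rule_format, OF order_refl assms(2)] show ?thesis
    using that by blast
qed

lemma weak_deriv_the_weak_deriv:
  assumes "u \<in> sobolev l p \<Omega>" and "\<alpha> \<in> multi_indices l"
  shows "weak_deriv \<Omega> \<alpha> u (the_weak_deriv \<Omega> \<alpha> u)"
proof -
  obtain g where "weak_deriv \<Omega> \<alpha> u g"
    using assms by (rule sobolev_obtains_weak_deriv)
  then show ?thesis
    unfolding the_weak_deriv_def using someI[of "weak_deriv \<Omega> \<alpha> u" g] by simp
qed

text \<open>
  The integral of a function that is not integrable is \<open>0\<close> by convention, so a vanishing norm is
  informative only for functions in \<open>L\<^sup>p\<close>. That the chosen weak derivative is one of them follows
  from its agreement almost everywhere with a weak derivative in \<open>L\<^sup>p\<close>.
\<close>

lemma the_weak_deriv_zero_on: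
  assumes "open \<Omega>" and u: "u \<in> sobolev l p \<Omega>" and \<alpha>: "\<alpha> \<in> multi_indices l"
    and zero: "Lp_norm p \<Omega> (the_weak_deriv \<Omega> \<alpha> u) = 0"
  shows "zero_on \<Omega> (the_weak_deriv \<Omega> \<alpha> u)"
proof -
  define D where "D = the_weak_deriv \<Omega> \<alpha> u"
  obtain g where g: "g \<in> Lp_on p \<Omega>" "weak_deriv \<Omega> \<alpha> u g"
    using that by (rule sobolev_obtains_weak_deriv[OF u \<alpha>])
  have "weak_deriv \<Omega> \<alpha> u D"
    unfolding D_def using u \<alpha> by (rule weak_deriv_the_weak_deriv)
  then have "zero_on \<Omega> (\<lambda>x. D x - g x)"
    by (rule weak_deriv_unique[OF \<open>open \<Omega>\<close> \<alpha> _ g(2)])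
  then have eq: "AE x in lebesgue. x \<in> \<Omega> \<longrightarrow> D x = g x"
    by (simp add: zero_on_def)
  let ?G = "\<lambda>x. indicator \<Omega> x *\<^sub>R \<bar>g x\<bar> powr p" and ?D = "\<lambda>x. indicator \<Omega> x *\<^sub>R \<bar>D x\<bar> powr p"
  have G: "integrable lebesgue ?G"
    using g(1) by (simp add: Lp_on_def set_integrable_def)
  have AE: "AE x in lebesgue. ?G x = ?D x"
    using eq by eventually_elim (auto simp: indicator_def)
  have D: "integrable lebesgue ?D"
    by (rule integrable_cong_AE_imp[OF G borel_measurable_AE[OF borel_measurable_integrable[OF G] AE] AE])
  have "(LINT x|lebesgue. ?D x) = 0"
    using zero by (simp add: Lp_norm_def set_lebesgue_integral_def D_def)
  then have "AE x in lebesgue. ?D x = 0"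
    using integral_nonneg_eq_0_iff_AE[OF D] by simp
  then show ?thesis
    unfolding zero_on_def D_def[symmetric] by eventually_elim (auto simp: indicator_def)
qed

lemma sobolev_seminorm_eq_0_iff:
  "sobolev_seminorm l p \<Omega> u = 0 \<longleftrightarrow>
    (\<forall>\<alpha>\<in>multi_indices l. Lp_norm p \<Omega> (the_weak_deriv \<Omega> \<alpha> u) = 0)"
  by (simp add: sobolev_seminorm_def sum_nonneg_eq_0_iff finite_multi_indices)

text \<open>
  Every multi-index of order \<open>l + 1\<close> arises from one of order \<open>l\<close> by one more differentiation.
\<close>

lemma sobolev_seminorm_Suc_eq_0:
  assumes "open \<Omega>" and u: "\<And>r. u \<in> sobolev r p \<Omega>"
    and zero: "sobolev_seminorm l p \<Omega> u = 0"
  shows "sobolev_seminorm (Suc l) p \<Omega> u = 0"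
  unfolding sobolev_seminorm_eq_0_iff
proof
  note weak = weak_deriv_the_weak_deriv[OF u]
  fix \<beta> :: "'a \<Rightarrow> nat" assume \<beta>: "\<beta> \<in> multi_indices (Suc l)"
  obtain b \<alpha> where b: "b \<in> Basis" and \<alpha>: "\<alpha> \<in> multi_indices l" and eq: "\<beta> = \<alpha>(b := Suc (\<alpha> b))"
    using that by (rule multi_indices_Suc_decompose[OF \<beta>])
  have "zero_on \<Omega> (the_weak_deriv \<Omega> \<alpha> u)"
    using the_weak_deriv_zero_on[OF \<open>open \<Omega>\<close> u \<alpha>] zero \<alpha> by (simp add: sobolev_seminorm_eq_0_iff)
  then have "zero_on \<Omega> (the_weak_deriv \<Omega> \<beta> u)"
    using weak_deriv_Suc_zero[OF \<open>open \<Omega>\<close> b \<alpha> weak[OF \<alpha>]] weak[OF \<beta>] unfolding eq by simp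
  then show "Lp_norm p \<Omega> (the_weak_deriv \<Omega> \<beta> u) = 0"
    by (rule Lp_norm_zero_on)
qed

lemma sobolev_seminorm_eq_0_mono:
  assumes "open \<Omega>" and "\<And>r. u \<in> sobolev r p \<Omega>"
    and "sobolev_seminorm l p \<Omega> u = 0" and "l \<le> j"
  shows "sobolev_seminorm j p \<Omega> u = 0"
  using assms(4)
proof (induction rule: dec_induct)
  case base
  show ?case by (fact assms(3))
next
  case (step i)
  then show ?case using sobolev_seminorm_Suc_eq_0[OF assms(1,2)] by simp
qed

section \<open>Growth of the radicand and pointwise convergence\<close>

text \<open>
  The absolute value is needed for negative radicands, because \<open>ln (- x) = ln x\<close>.
\<close>

lemma powr_inverse_power:
  fixes x :: real
  assumes "q \<ge> 1" "x \<noteq> 0"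
  shows "(x powr (1 / real q)) ^ q = \<bar>x\<bar>"
proof -
  have "(x powr (1 / real q)) ^ q = exp (real q * (1 / real q * ln x))"
    using assms by (simp add: powr_def exp_of_nat_mult[symmetric])
  also have "\<dots> = exp (ln x)" using assms by simp
  also have "\<dots> = \<bar>x\<bar>"
    using assms(2) ln_minus[of x] exp_ln[of "- x"] by (cases "x > 0") auto
  finally show ?thesis .
qed

lemma ratio_tendsto_mult:
  fixes f g :: "nat \<Rightarrow> real"
  assumes "(\<lambda>q. f q / f (Suc q)) \<longlonglongrightarrow> a" and "(\<lambda>q. g q / g (Suc q)) \<longlonglongrightarrow> b"
  shows "(\<lambda>q. (f q * g q) / (f (Suc q) * g (Suc q))) \<longlonglongrightarrow> a * b"
  using tendsto_mult[OF assms] by simp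

lemma ratio_tendsto_power:
  fixes f :: "nat \<Rightarrow> real"
  assumes "(\<lambda>q. f q / f (Suc q)) \<longlonglongrightarrow> 1"
  shows "(\<lambda>q. f q ^ n / f (Suc q) ^ n) \<longlonglongrightarrow> 1"
  using tendsto_power[OF assms, of n] by (simp add: power_divide)

lemma ratio_tendsto_1_if_convergent:
  fixes f :: "nat \<Rightarrow> real"
  assumes "f \<longlonglongrightarrow> c" "c \<noteq> 0"
  shows "(\<lambda>q. f q / f (Suc q)) \<longlonglongrightarrow> 1"
  using tendsto_divide[OF assms(1) LIMSEQ_Suc[OF assms(1)] assms(2)] assms(2) by simp

lemma ratio_tendsto_1_affine:
  fixes c x :: real
  shows "c \<noteq> 0 \<Longrightarrow> (\<lambda>q. (c / (x + real q)) / (c / (x + real (Suc q)))) \<longlonglongrightarrow> 1"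
    and "c \<noteq> 0 \<Longrightarrow> (\<lambda>q. ((x + real q) / c) / ((x + real (Suc q)) / c)) \<longlonglongrightarrow> 1"
proof -
  have "(\<lambda>q. (x + (real q + 1)) / (x + real q)) \<longlonglongrightarrow> 1"
    "(\<lambda>q. (x + real q) / (x + (real q + 1))) \<longlonglongrightarrow> 1"
    by real_asymp+
  then show "c \<noteq> 0 \<Longrightarrow> (\<lambda>q. (c / (x + real q)) / (c / (x + real (Suc q)))) \<longlonglongrightarrow> 1"
    and "c \<noteq> 0 \<Longrightarrow> (\<lambda>q. ((x + real q) / c) / ((x + real (Suc q)) / c)) \<longlonglongrightarrow> 1"
    by (simp_all add: add_ac)
qed

text \<open>
  The ratio of consecutive terms is multiplicative, so each factor is treated separately. The
  limits are \<open>1\<close> for the inf-sup factor, the two powers and the affine factor, \<open>0\<close> for the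
  factorial and \<open>l\<close> for the seminorms.
\<close>

lemma h_star_radicand_ratio:
  fixes A :: real and S \<alpha> :: "nat \<Rightarrow> real"
  assumes "k \<ge> 1" "m \<le> k" "A \<ge> 0" "\<alpha> k > 0"
    and \<alpha>: "(\<lambda>q. \<alpha> (k + q)) \<longlonglongrightarrow> \<alpha>'" "\<alpha>' > 0"
    and nz: "real k + 1 - real m - real n / p \<noteq> 0"
    and S: "S (k + 1) \<noteq> 0" "(\<lambda>q. S (k + q + 2) / S (k + q + 1)) \<longlonglongrightarrow> l" "l > 0"
  defines "X \<equiv> \<lambda>q. (1 + A / \<alpha> k) / (1 + A / \<alpha> (k + q))
      * (real (k + n) / real (k + q + n)) ^ n
      * (real k / real (k + q)) ^ (m * (n + 2))
      * (fact (k + q - m) / fact (k - m))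
      * ((real k + real q + 1 - real m - real n / p) / (real k + 1 - real m - real n / p))
      * (S (k + 1) / S (k + q + 1))"
  shows "(\<lambda>q. X q / X (Suc q)) \<longlonglongrightarrow> 0" and "\<forall>\<^sub>F q in sequentially. X q \<noteq> 0"
proof -
  have C: "1 + A / \<alpha> k > 0" using assms by (intro add_pos_nonneg) auto
  have C': "1 + A / \<alpha>' > 0" using assms by (intro add_pos_nonneg) auto
  let ?f = "\<lambda>q. (1 + A / \<alpha> k) / (1 + A / \<alpha> (k + q))"
  have f_lim: "?f \<longlonglongrightarrow> (1 + A / \<alpha> k) / (1 + A / \<alpha>')"
    using C' \<alpha>(2) by (intro tendsto_intros \<alpha>(1)) auto
  have f: "(\<lambda>q. ?f q / ?f (Suc q)) \<longlonglongrightarrow> 1"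
    using C C' by (intro ratio_tendsto_1_if_convergent[OF f_lim]) auto
  have f_nz: "\<forall>\<^sub>F q in sequentially. ?f q \<noteq> 0"
    using C C' by (intro tendsto_imp_eventually_ne[OF f_lim]) auto
  have g: "(\<lambda>q. (real (k + n) / real (k + q + n)) ^ n / (real (k + n) / real (k + Suc q + n)) ^ n) \<longlonglongrightarrow> 1"
    using ratio_tendsto_1_affine(1)[of "real (k + n)" "real (k + n)"] assms(1)
    by (intro ratio_tendsto_power) (simp add: add_ac)
  have j: "(\<lambda>q. (real k / real (k + q)) ^ (m * (n + 2)) / (real k / real (k + Suc q)) ^ (m * (n + 2))) \<longlonglongrightarrow> 1"
    using ratio_tendsto_1_affine(1)[of "real k" "real k"] assms(1)
    by (intro ratio_tendsto_power) (simp add: add_ac)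
  have F: "(\<lambda>q. (fact (k + q - m) / fact (k - m)) / (fact (k + Suc q - m) / fact (k - m))) \<longlonglongrightarrow> (0::real)"
  proof -
    have "(\<lambda>q. 1 / (real q + (real (k - m) + 1))) \<longlonglongrightarrow> 0" by real_asymp
    moreover have "(fact (k + q - m) / fact (k - m)) / (fact (k + Suc q - m) / fact (k - m)) =
        1 / (real q + (real (k - m) + 1))" for q
    proof -
      have "fact (k + Suc q - m) = (real q + (real (k - m) + 1)) * fact (k + q - m)"
        using \<open>m \<le> k\<close> by (simp add: Suc_diff_le of_nat_diff)
      then show ?thesis by simp
    qed
    ultimately show ?thesis by simp
  qed
  have L: "(\<lambda>q. ((real k + real q + 1 - real m - real n / p) / (real k + 1 - real m - real n / p)) /
      ((real k + real (Suc q) + 1 - real m - real n / p) / (real k + 1 - real m - real n / p))) \<longlonglongrightarrow> 1"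
    using ratio_tendsto_1_affine(2)[OF nz, of "real k + 1 - real m - real n / p"]
    by (simp add: algebra_simps)
  have Sr: "(\<lambda>q. (S (k + 1) / S (k + q + 1)) / (S (k + 1) / S (k + Suc q + 1))) \<longlonglongrightarrow> l"
    using S(1,2) by simp
  show "(\<lambda>q. X q / X (Suc q)) \<longlonglongrightarrow> 0"
    using ratio_tendsto_mult[OF ratio_tendsto_mult[OF ratio_tendsto_mult[OF
      ratio_tendsto_mult[OF ratio_tendsto_mult[OF f g] j] F] L] Sr]
    unfolding X_def by simp
  have S_nz: "\<forall>\<^sub>F q in sequentially. S (k + q + 1) \<noteq> 0"
    using tendsto_imp_eventually_ne[OF S(2), of 0] S(3) by (auto elim!: eventually_mono)
  have L_nz: "\<forall>\<^sub>F q in sequentially. real k + real q + 1 - real m - real n / p \<noteq> 0"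
    using eventually_compose_filterlim[OF eventually_gt_at_top[of "real m + real n / p - real k - 1"]
      filterlim_real_sequentially]
    by eventually_elim simp
  show "\<forall>\<^sub>F q in sequentially. X q \<noteq> 0"
    using f_nz S_nz L_nz
    by eventually_elim (use assms(1) nz S(1) in \<open>auto simp: X_def\<close>)
qed

text \<open>
  The ratio test makes \<open>\<Sum> t\<^sup>q / X q\<close> converge, so its terms tend to \<open>0\<close>.
\<close>

lemma power_div_tendsto_0:
  fixes X :: "nat \<Rightarrow> real"
  assumes ratio: "(\<lambda>q. X q / X (Suc q)) \<longlonglongrightarrow> 0" and nz: "\<forall>\<^sub>F q in sequentially. X q \<noteq> 0"
  shows "(\<lambda>q. t ^ q / X q) \<longlonglongrightarrow> 0"
proof -
  have "(\<lambda>q. t * (X q / X (Suc q))) \<longlonglongrightarrow> t * 0"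
    by (intro tendsto_intros ratio)
  then have "\<forall>\<^sub>F q in sequentially. \<bar>t * (X q / X (Suc q))\<bar> < 1 / 2"
    by (auto dest!: tendstoD[where e = "1 / 2"] simp: dist_real_def)
  then have "\<forall>\<^sub>F q in sequentially. norm (t ^ Suc q / X (Suc q)) \<le> 1 / 2 * norm (t ^ q / X q)"
    using nz
  proof eventually_elim
    case (elim q)
    have "norm (t ^ Suc q / X (Suc q)) = \<bar>t * (X q / X (Suc q))\<bar> * norm (t ^ q / X q)"
      using elim(2) by (simp add: abs_mult)
    also have "\<dots> \<le> 1 / 2 * norm (t ^ q / X q)"
      using elim(1) by (intro mult_right_mono) auto
    finally show ?case .
  qed
  then obtain N where "\<And>q. q \<ge> N \<Longrightarrow> norm (t ^ Suc q / X (Suc q)) \<le> 1 / 2 * norm (t ^ q / X q)"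
    by (auto simp: eventually_sequentially)
  then have "summable (\<lambda>q. t ^ q / X q)"
    by (intro summable_ratio_test[of "1 / 2" N]) auto
  then show ?thesis by (rule summable_LIMSEQ_zero)
qed

text \<open>
  The number \<open>t\<^sup>q / \<bar>X q\<bar>\<close> is the \<open>q\<close>-th power of \<open>t\<close> divided by the critical mesh size. Once it is below
  \<open>1\<close>, so is the base, and the second branch of the law applies.
\<close>

lemma prob_law_tendsto:
  assumes ratio: "(\<lambda>q. X q / X (Suc q)) \<longlonglongrightarrow> 0" and nz: "\<forall>\<^sub>F q in sequentially. X q \<noteq> 0"
    and "t > 0"
  shows "(\<lambda>q. prob_law (X q powr (1 / real q)) q t) \<longlonglongrightarrow> 1"
proof -
  have lim: "(\<lambda>q. \<bar>t ^ q / X q\<bar>) \<longlonglongrightarrow> 0"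
    by (rule tendsto_rabs_zero[OF power_div_tendsto_0[OF ratio nz]])
  then have "(\<lambda>q. 1 - 1 / 2 * \<bar>t ^ q / X q\<bar>) \<longlonglongrightarrow> 1 - 1 / 2 * 0"
    by (intro tendsto_intros)
  moreover have "\<forall>\<^sub>F q in sequentially. \<bar>t ^ q / X q\<bar> < 1"
    using order_tendstoD(2)[OF lim] by simp
  then have "\<forall>\<^sub>F q in sequentially. 1 - 1 / 2 * \<bar>t ^ q / X q\<bar> = prob_law (X q powr (1 / real q)) q t"
    using nz eventually_ge_at_top[of "1::nat"]
  proof eventually_elim
    case (elim q)
    let ?s = "X q powr (1 / real q)"
    have "?s > 0" using elim(2) by (simp add: powr_def)
    have pow: "(t / ?s) ^ q = \<bar>t ^ q / X q\<bar>"
      using elim powr_inverse_power[of q "X q"] \<open>t > 0\<close> by (simp add: power_divide abs_divide)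
    have "t / ?s < 1"
    proof (rule ccontr)
      assume "\<not> t / ?s < 1"
      then have "1 \<le> (t / ?s) ^ q" by (intro one_le_power) auto
      then show False using pow elim(1) by simp
    qed
    then have "t \<le> ?s" using \<open>?s > 0\<close> by (simp add: field_simps)
    then show ?case using pow \<open>t > 0\<close> by (simp add: prob_law_def)
  qed
  ultimately show ?thesis by (auto intro: Lim_transform_eventually)
qed

section \<open>Weak-* convergence to the Heaviside distribution\<close>

lemma prob_law_bounds:
  assumes "s \<ge> 0"
  shows "0 \<le> prob_law s q t" "prob_law s q t \<le> 1"
proof -
  have "(t / s) ^ q \<le> 1" "0 \<le> (t / s) ^ q" if "0 < t" "t \<le> s"
    using that by (auto intro!: power_le_one)
  moreover have "(s / t) ^ q \<le> 1" "0 \<le> (s / t) ^ q" if "0 < t" "\<not> t \<le> s"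
    using that assms by (auto intro!: power_le_one)
  ultimately show "0 \<le> prob_law s q t" "prob_law s q t \<le> 1"
    by (auto simp: prob_law_def)
qed

lemma prob_law_measurable: "prob_law s q \<in> borel_measurable borel"
  unfolding prob_law_def[abs_def] by measurable

lemma regular_distribution_integrable:
  assumes f: "f \<in> borel_measurable borel" and bound: "\<And>x. \<bar>f x\<bar> \<le> 1"
    and \<phi>: "\<phi> \<in> test_functions (UNIV :: real set)"
  shows "integrable lebesgue (\<lambda>x. f x * \<phi> x)"
proof -
  have "locally_integrable UNIV f"
    unfolding locally_integrable_def set_integrable_def
  proof safe
    fix K :: "real set" assume K: "compact K"
    show "integrable lebesgue (\<lambda>x. indicator K x *\<^sub>R f x)"
    proof (rule Bochner_Integration.integrable_bound)
      show "integrable lebesgue (indicator K :: real \<Rightarrow> real)"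
        using lmeasurable_compact[OF K] by (auto simp: fmeasurable_def less_top intro!: integrable_real_indicator)
      show "(\<lambda>x. indicator K x *\<^sub>R f x) \<in> borel_measurable lebesgue"
        using f K
        by (intro measurable_completion borel_measurable_scaleR borel_measurable_indicator)
           (auto intro: borel_compact)
      show "AE x in lebesgue. norm (indicator K x *\<^sub>R f x) \<le> norm (indicator K x :: real)"
        using bound by (auto simp: indicator_def)
    qed
  qed
  from set_integrable_times_test_function[OF this \<phi>] show ?thesis
    by (simp add: set_integrable_def)
qed

text \<open>
  The order is \<open>0\<close>: on test functions supported in \<open>K\<close> the functional is bounded by the measure of
  \<open>K\<close> times the supremum norm.
\<close>

lemma bounded_regular_distribution:
  assumes f: "f \<in> borel_measurable borel" and bound: "\<And>x. \<bar>f x\<bar> \<le> 1"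
  shows "distribution (regular_distribution f)"
  unfolding distribution_def
proof (intro conjI ballI allI impI)
  note int = regular_distribution_integrable[OF f bound]
  fix \<phi> :: "real \<Rightarrow> real" assume \<phi>: "\<phi> \<in> test_functions UNIV"
  show "regular_distribution f (\<lambda>x. c * \<phi> x) = c * regular_distribution f \<phi>" for c
    unfolding regular_distribution_def by (simp add: mult.left_commute)
  fix \<psi> :: "real \<Rightarrow> real" assume \<psi>: "\<psi> \<in> test_functions UNIV"
  show "regular_distribution f (\<lambda>x. \<phi> x + \<psi> x) = regular_distribution f \<phi> + regular_distribution f \<psi>"
    unfolding regular_distribution_def using int[OF \<phi>] int[OF \<psi>] by (simp add: distrib_left)
next
  note int = regular_distribution_integrable[OF f bound]
  fix K :: "real set" assume K: "compact K"
  have K_int: "integrable lebesgue (indicator K :: real \<Rightarrow> real)"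
    using lmeasurable_compact[OF K] by (auto simp: fmeasurable_def less_top intro!: integrable_real_indicator)
  have "\<bar>regular_distribution f \<phi>\<bar> \<le> measure lebesgue K * (\<Sum>j\<le>0. SUP x. \<bar>(deriv ^^ j) \<phi> x\<bar>)"
    if \<phi>: "\<phi> \<in> test_functions UNIV" and supp: "\<forall>x. x \<notin> K \<longrightarrow> \<phi> x = 0" for \<phi>
  proof -
    let ?M = "SUP x. \<bar>\<phi> x\<bar>"
    obtain B where "\<And>x. \<bar>\<phi> x\<bar> \<le> B" using test_function_bounded[OF \<phi>] by blast
    then have "bdd_above (range (\<lambda>x. \<bar>\<phi> x\<bar>))" by (auto intro!: bdd_aboveI[of _ B])
    then have M: "\<bar>\<phi> x\<bar> \<le> ?M" for x by (rule cSUP_upper[OF UNIV_I])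
    have "\<bar>regular_distribution f \<phi>\<bar> \<le> (LINT x|lebesgue. \<bar>f x * \<phi> x\<bar>)"
      unfolding regular_distribution_def using integral_norm_bound[of lebesgue "\<lambda>x. f x * \<phi> x"] by simp
    also have "\<dots> \<le> (LINT x|lebesgue. ?M * indicator K x)"
    proof (rule integral_mono)
      show "integrable lebesgue (\<lambda>x. \<bar>f x * \<phi> x\<bar>)" using int[OF \<phi>] by simp
      show "integrable lebesgue (\<lambda>x. ?M * indicator K x)" using K_int by simp
      show "\<bar>f x * \<phi> x\<bar> \<le> ?M * indicator K x" for x
      proof (cases "x \<in> K")
        case True
        have "\<bar>f x\<bar> * \<bar>\<phi> x\<bar> \<le> 1 * ?M" using bound M by (intro mult_mono) auto
        with True show ?thesis by (simp add: abs_mult)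
      qed (simp add: supp)
    qed
    also have "\<dots> = measure lebesgue K * ?M" by simp
    finally show ?thesis by simp
  qed
  then show "\<exists>C N. \<forall>\<phi>\<in>test_functions UNIV. (\<forall>x. x \<notin> K \<longrightarrow> \<phi> x = 0) \<longrightarrow>
      \<bar>regular_distribution f \<phi>\<bar> \<le> C * (\<Sum>j\<le>(N::nat). SUP x. \<bar>(deriv ^^ j) \<phi> x\<bar>)"
    by blast
qed

lemma heaviside_regular: "heaviside_distribution = regular_distribution (indicator {0..})"
  by (simp add: fun_eq_iff heaviside_distribution_def regular_distribution_def set_lebesgue_integral_def)

lemma prob_laws_converge_weak_star:
  assumes nonneg: "\<And>q. s q \<ge> 0"
    and lim: "\<And>t. t > 0 \<Longrightarrow> (\<lambda>q. prob_law (s q) q t) \<longlonglongrightarrow> 1"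
  shows "converges_weak_star (\<lambda>q. regular_distribution (prob_law (s q) q)) heaviside_distribution"
  unfolding converges_weak_star_def
proof (intro conjI allI impI ballI)
  have bound: "\<bar>prob_law (s q) q t\<bar> \<le> 1" for q t
    using prob_law_bounds[OF nonneg, of q q t] by simp
  show "distribution (regular_distribution (prob_law (s q) q))" for q
    by (rule bounded_regular_distribution[OF prob_law_measurable bound])
  have H: "(indicator {0..} :: real \<Rightarrow> real) \<in> borel_measurable borel" by measurable
  have H_bound: "\<bar>indicator {0..} x :: real\<bar> \<le> 1" for x :: real by (simp add: indicator_def)
  show "distribution heaviside_distribution"
    unfolding heaviside_regular by (rule bounded_regular_distribution[OF H H_bound])
  fix \<phi> :: "real \<Rightarrow> real" assume \<phi>: "\<phi> \<in> test_functions UNIV"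
  note int = regular_distribution_integrable[OF _ _ \<phi>]
  show "(\<lambda>q. regular_distribution (prob_law (s q) q) \<phi>) \<longlonglongrightarrow> heaviside_distribution \<phi>"
    unfolding heaviside_regular regular_distribution_def
  proof (rule integral_dominated_convergence)
    show "(\<lambda>x. indicator {0..} x * \<phi> x) \<in> borel_measurable lebesgue"
      using int[OF H H_bound] by (rule borel_measurable_integrable)
    show "(\<lambda>x. prob_law (s q) q x * \<phi> x) \<in> borel_measurable lebesgue" for q
      using int[OF prob_law_measurable bound] by (rule borel_measurable_integrable)
    show "integrable lebesgue (\<lambda>x. \<bar>\<phi> x\<bar>)"
      using int[of "\<lambda>_. 1"] by simp
    \<comment> \<open>At \<open>0\<close> every law has the value \<open>0\<close>, whereas the indicator function has the value \<open>1\<close>.\<close>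
    have "AE x in lebesgue. x \<noteq> (0::real)"
      by (rule AE_completion) (rule AE_lborel_singleton)
    then show "AE x in lebesgue. (\<lambda>q. prob_law (s q) q x * \<phi> x) \<longlonglongrightarrow> indicator {0..} x * \<phi> x"
    proof eventually_elim
      case (elim x)
      show ?case
      proof (cases "x > 0")
        case True
        then show ?thesis using tendsto_mult_right[OF lim[OF True]] by simp
      next
        case False
        then show ?thesis using elim by (simp add: prob_law_def)
      qed
    qed
    show "AE x in lebesgue. norm (prob_law (s q) q x * \<phi> x) \<le> \<bar>\<phi> x\<bar>" for q
      using bound by (auto simp: abs_mult intro!: mult_left_le_one_le)
  qed
qed

section \<open>The norm of the form and the limit of the laws\<close>

text \<open>
  Continuity of the form is what makes the set of admissible constants nonempty; the infimum of
  the empty set has an unspecified value.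
\<close>

lemma bilinear_form_norm_nonneg:
  assumes "continuous_bilinear_form W nW V nV a"
    and "\<And>w. nW w \<ge> 0" "\<And>v. nV v \<ge> 0"
  shows "bilinear_form_norm W nW V nV a \<ge> 0"
  unfolding bilinear_form_norm_def
proof (rule cInf_greatest)
  obtain C where C: "\<And>w v. w \<in> W \<Longrightarrow> v \<in> V \<Longrightarrow> \<bar>a w v\<bar> \<le> C * nW w * nV v"
    using assms(1) unfolding continuous_bilinear_form_def by blast
  have "\<bar>a w v\<bar> \<le> max C 1 * nW w * nV v" if "w \<in> W" "v \<in> V" for w v
    by (rule order_trans[OF C[OF that]]) (auto intro!: mult_right_mono assms(2,3))
  then show "{C. 0 < C \<and> (\<forall>w\<in>W. \<forall>v\<in>V. \<bar>a w v\<bar> \<le> C * nW w * nV v)} \<noteq> {}"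
    by (auto intro!: exI[of _ "max C 1"])
qed auto

theorem theorem5p2:
  fixes \<Omega> :: "'a::euclidean_space set"
    and m m' k :: nat and p p' :: real
    and W V :: "('a \<Rightarrow> real) set" and nW nV :: "('a \<Rightarrow> real) \<Rightarrow> real"
    and a :: "('a \<Rightarrow> real) \<Rightarrow> ('a \<Rightarrow> real) \<Rightarrow> real" and l :: "('a \<Rightarrow> real) \<Rightarrow> real"
    and u :: "'a \<Rightarrow> real"
    and \<alpha> :: real and \<sigma> h :: real and \<T> :: "'a set set"
    and W\<^sub>h V\<^sub>h :: "nat \<Rightarrow> ('a \<Rightarrow> real) set"
    and \<alpha>\<^sub>h \<alpha>\<^sub>h_lim :: "nat \<Rightarrow> real" and l\<^sub>0 :: real
  defines "W \<equiv> sobolev m p \<Omega>" and "V \<equiv> sobolev m' p' \<Omega>"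
    and "nW \<equiv> sobolev_norm m p \<Omega>" and "nV \<equiv> sobolev_norm m' p' \<Omega>"
  assumes "open \<Omega>"
    and "m \<ge> 1" and "m' \<ge> 1"
    and "p > 0" and "p \<noteq> 2" and "p' > 1" and "1 / p + 1 / p' = 1"
    and "continuous_linear_form V nV l"
    and "continuous_bilinear_form W nW V nV a"
    and "\<alpha> > 0" and "inf_sup \<Omega> W nW V nV a \<ge> ereal \<alpha>"
    and "nondegenerate \<Omega> W V a"
    and "\<forall>r. u \<in> sobolev r p \<Omega>"
    and "u \<in> W" and "\<forall>v\<in>V. a u v = l v"
    and "regular_mesh \<sigma> h \<Omega> \<T>"
    and "\<forall>j\<ge>1. finite_element_space j \<T> W (W\<^sub>h j) \<and> finite_element_space j \<T> V (V\<^sub>h j) \<and>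
                 fun_vs.dim (W\<^sub>h j) = fun_vs.dim (V\<^sub>h j)"
    and "\<forall>j\<ge>1. \<alpha>\<^sub>h j > 0 \<and> inf_sup \<Omega> (W\<^sub>h j) nW (V\<^sub>h j) nV a \<ge> ereal (\<alpha>\<^sub>h j)"
    and "\<forall>j\<ge>1. nondegenerate \<Omega> (W\<^sub>h j) (V\<^sub>h j) a"
    and "real DIM('a) / p < 1 \<longrightarrow> m \<le> k"
    and "real DIM('a) / p \<ge> 1 \<longrightarrow> m + 1 \<le> k \<and> real k + 1 - real DIM('a) / p > 0"
    and "real k + 1 - real m - real DIM('a) / p \<noteq> 0"
    and "\<forall>j. (\<lambda>q. \<alpha>\<^sub>h (j + q)) \<longlonglongrightarrow> \<alpha>\<^sub>h_lim j \<and> \<alpha>\<^sub>h_lim j \<noteq> 0"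
    and "l\<^sub>0 > 0"
    and "(\<lambda>q. sobolev_seminorm (k + q + 2) p \<Omega> u / sobolev_seminorm (k + q + 1) p \<Omega> u)
           \<longlonglongrightarrow> l\<^sub>0"
  shows "converges_weak_star
           (\<lambda>q. regular_distribution
                  (prob_law (h_star DIM('a) m p k (bilinear_form_norm W nW V nV a) \<alpha>\<^sub>h
                              (\<lambda>j. sobolev_seminorm j p \<Omega> u) q) q))
           heaviside_distribution"
proof -
  define A where "A = bilinear_form_norm W nW V nV a"
  define S where "S = (\<lambda>j. sobolev_seminorm j p \<Omega> u)"
  have "m \<le> k"
    using \<open>real DIM('a) / p < 1 \<longrightarrow> m \<le> k\<close>
      \<open>real DIM('a) / p \<ge> 1 \<longrightarrow> m + 1 \<le> k \<and> real k + 1 - real DIM('a) / p > 0\<close>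
    by (cases "real DIM('a) / p < 1") auto
  then have "k \<ge> 1" using \<open>m \<ge> 1\<close> by linarith
  have "A \<ge> 0"
    unfolding A_def using \<open>continuous_bilinear_form W nW V nV a\<close>
    by (rule bilinear_form_norm_nonneg) (simp_all add: nW_def nV_def sobolev_norm_def)
  have \<alpha>_pos: "\<alpha>\<^sub>h j > 0" if "j \<ge> 1" for j
    using \<open>\<forall>j\<ge>1. \<alpha>\<^sub>h j > 0 \<and> inf_sup \<Omega> (W\<^sub>h j) nW (V\<^sub>h j) nV a \<ge> ereal (\<alpha>\<^sub>h j)\<close> that by simp
  have \<alpha>_lim: "(\<lambda>q. \<alpha>\<^sub>h (k + q)) \<longlonglongrightarrow> \<alpha>\<^sub>h_lim k" "\<alpha>\<^sub>h_lim k \<noteq> 0"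
    using \<open>\<forall>j. (\<lambda>q. \<alpha>\<^sub>h (j + q)) \<longlonglongrightarrow> \<alpha>\<^sub>h_lim j \<and> \<alpha>\<^sub>h_lim j \<noteq> 0\<close> by simp_all
  have "0 < \<alpha>\<^sub>h (k + q)" for q
    using \<alpha>_pos[of "k + q"] \<open>k \<ge> 1\<close> by simp
  then have "\<alpha>\<^sub>h_lim k \<ge> 0"
    by (intro LIMSEQ_le_const[OF \<alpha>_lim(1)] exI[of _ 0] allI impI less_imp_le)
  with \<alpha>_lim(2) have "\<alpha>\<^sub>h_lim k > 0" by simp
  have S_lim: "(\<lambda>q. S (k + q + 2) / S (k + q + 1)) \<longlonglongrightarrow> l\<^sub>0"
    unfolding S_def by fact
  have u: "u \<in> sobolev r p \<Omega>" for r
    using \<open>\<forall>r. u \<in> sobolev r p \<Omega>\<close> by simp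
  \<comment> \<open>Otherwise all quotients of seminorms would be \<open>0 / 0 = 0\<close>, against their limit being positive.\<close>
  have "S (k + 1) \<noteq> 0"
  proof
    assume "S (k + 1) = 0"
    then have "sobolev_seminorm (k + 1) p \<Omega> u = 0"
      by (simp add: S_def)
    then have "S (k + q + 1) = 0" for q
      unfolding S_def by (rule sobolev_seminorm_eq_0_mono[OF \<open>open \<Omega>\<close> u]) simp
    then have "(\<lambda>q. S (k + q + 2) / S (k + q + 1)) = (\<lambda>_. 0)"
      by simp
    then have "l\<^sub>0 = 0"
      using S_lim by (simp add: LIMSEQ_const_iff)
    with \<open>l\<^sub>0 > 0\<close> show False by simp
  qed
  note radicand = h_star_radicand_ratio[where \<alpha> = \<alpha>\<^sub>h and S = S and A = A and n = "DIM('a)" and p = p,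
      OF \<open>k \<ge> 1\<close> \<open>m \<le> k\<close> \<open>A \<ge> 0\<close> \<alpha>_pos[OF \<open>k \<ge> 1\<close>] \<alpha>_lim(1) \<open>\<alpha>\<^sub>h_lim k > 0\<close>
      \<open>real k + 1 - real m - real DIM('a) / p \<noteq> 0\<close> \<open>S (k + 1) \<noteq> 0\<close> S_lim \<open>l\<^sub>0 > 0\<close>]
  have "converges_weak_star
      (\<lambda>q. regular_distribution (prob_law (h_star DIM('a) m p k A \<alpha>\<^sub>h S q) q)) heaviside_distribution"
  proof (rule prob_laws_converge_weak_star)
    show "h_star DIM('a) m p k A \<alpha>\<^sub>h S q \<ge> 0" for q
      by (simp add: h_star_def)
    show "(\<lambda>q. prob_law (h_star DIM('a) m p k A \<alpha>\<^sub>h S q) q t) \<longlonglongrightarrow> 1" if "t > 0" for t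
      unfolding h_star_def by (rule prob_law_tendsto[OF radicand that])
  qed
  then show ?thesis
    unfolding A_def S_def .
qed

end
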